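(* Let $\mathbf{K}$ be a $\mu$-AEC, let $M\in\mathbf{K}$, and let $\lambda:=|UM|$. Assume that $\lambda>\mathrm{LS}(\mathbf{K})$ and assume GCH (or just $\mathrm{SCH}_{\mu,\lambda}$). (1) If $\lambda$ is not the successor of a cardinal of cofinality less than $\mu$, then $r_{\mathbf{K}}(M)=\lambda^+$, so $|M|_{\mathbf{K}}=\lambda$. (2) If $\lambda=\lambda_0^+$ for some cardinal $\lambda_0$ with $\mathrm{cf}(\lambda_0)<\mu$, then $|M|_{\mathbf{K}}$ is either $\lambda_0$ or $\lambda$.
   Context: Let $\mu$ be a regular infinite cardinal. A ($\mu$-ary) abstract class is a pair $\mathbf{K}=(K,\le_{\mathbf{K}})$ where $K$ is a class of structures in a fixed vocabulary $\tau=\tau(\mathbf{K})$ whose symbols have arity $<\mu$, and $\le_{\mathbf{K}}$ is a partial order on $K$ that (together with $K$) respects isomorphisms and extends the $\tau$-substructure relation. $UM$ denotes the universe of $M$. $\mathbf{K}$ is regarded as a category whose morphisms $f:M\to N$ are the $\mathbf{K}$-embeddings: isomorphisms of $M$ onto some $f[M]$ with $f[M]\le_{\mathbf{K}}N$. An abstract class $\mathbf{K}$ is a $\mu$-AEC if: (i) Coherence: if $M_0,M_1,M_2\in\mathbf{K}$, $M_0\subseteq M_1\le_{\mathbf{K}}M_2$ and $M_0\le_{\mathbf{K}}M_2$, then $M_0\le_{\mathbf{K}}M_1$. (ii) Chain axioms: if $\langle M_i:i\in I\rangle$ is a $\mu$-directed system in $\mathbf{K}$ (w.r.t. $\le_{\mathbf{K}}$),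 then $M:=\bigcup_i M_i\in\mathbf{K}$, $M_i\le_{\mathbf{K}}M$ for all $i$, and if $M_i\le_{\mathbf{K}}N$ for all $i$ then $M\le_{\mathbf{K}}N$. (iii) Löwenheim–Skolem–Tarski: there is a cardinal $\lambda=\lambda^{<\mu}\ge|\tau(\mathbf{K})|+\mu$ such that for all $M\in\mathbf{K}$ and $A\subseteq UM$ there is $M_0\le_{\mathbf{K}}M$ with $A\subseteq UM_0$ and $|UM_0|\le|A|^{<\mu}+\lambda$. The least such $\lambda$ is $\mathrm{LS}(\mathbf{K})$. For regular $\lambda$, an object $M$ of a category is $\lambda$-presentable if its covariant hom-functor preserves colimits indexed by $\lambda$-directed posets (posets in which every subset of size $<\lambda$ has an upper bound). The presentability rank $r_{\mathbf{K}}(M)$ is the least regular $\lambda$ such that $M$ is $\lambda$-presentable in the category $\mathbf{K}$. The internal size is $|M|_{\mathbf{K}}:=\chi$ if $r_{\mathbf{K}}(M)=\chi^+$, and $|M|_{\mathbf{K}}:=r_{\mathbf{K}}(M)$ if $r_{\mathbf{K}}(M)$ is a limit cardinal. A cardinal $\chi\ge\mu$ is almost $\mu$-closed if $\theta^{<\mu}\le\chi$ for all cardinals $\theta<\chi$. $\mathrm{SCH}_{\mu,\lambda}$ is the statement: there is a set $S$ of cardinals with $\mu\le\chi<\lambda$ for every $\chi\in S$, such that $S$ is unbounded in $\lambda$ (for every cardinal $\theta<\lambda$ there is $\chi\in S$ with $\theta\le\chi$) and every $\chi\in S$ is almost $\mu$-closed. *)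

theory Defs
  imports Main "HOL-Library.FuncSet"
begin

unbundle cardinal_syntax

text \<open>
  The type variable \<open>'u\<close> plays the role of the universe of sets. A set is \<^emph>\<open>small\<close> if it has fewer
  elements than \<open>'u\<close>; structures have small universes contained in \<open>'u\<close>, diagrams are indexed by
  small posets on \<open>'u\<close>, and cardinals are cardinal orders on small subsets of \<open>'u\<close>, compared up to
  \<open>=o\<close>. If the cardinality of \<open>'u\<close> is inaccessible, this is a Grothendieck universe, and
  classes are collections of small objects. Since the existence of such a type is not provable in
  HOL, it is not required anywhere; it suffices that \<open>'u\<close> is large compared with the structure
  under consideration.
\<close>

definition small :: "'u set \<Rightarrow> bool" where
  "small A \<longleftrightarrow> |A| <o |UNIV :: 'u set|"


section \<open>Cardinals\<close>

definition cardinal :: "'u rel \<Rightarrow> bool" where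
  "cardinal r \<longleftrightarrow> Card_order r \<and> small (Field r)"

definition regular_cardinal :: "'u rel \<Rightarrow> bool" where
  "regular_cardinal r \<longleftrightarrow> cardinal r \<and> cinfinite r \<and> regularCard r"

text \<open>Only meaningful for infinite \<open>r\<close>: the library notion \<^const>\<open>cofinal\<close> is strict, hence
  void for orders with a greatest element.\<close>

definition cofinality :: "'u rel \<Rightarrow> 'u rel" where
  "cofinality r = |SOME A. A \<subseteq> Field r \<and> cofinal A r \<and>
     (\<forall>B. B \<subseteq> Field r \<and> cofinal B r \<longrightarrow> |A| \<le>o |B| )|"

definition limit_cardinal :: "'u rel \<Rightarrow> bool" where
  "limit_cardinal r \<longleftrightarrow>
     cardinal r \<and> cinfinite r \<and> \<not> (\<exists>c :: 'u rel. cardinal c \<and> r =o cardSuc c)"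

text \<open>\<open>weak_power \<theta> \<mu>\<close> is \<open>\<theta>\<close> to the power \<open><\<mu>\<close>: the number of sequences in \<open>\<theta>\<close> whose length is an
  ordinal below \<open>\<mu>\<close>. For \<open>\<theta> \<ge> 2\<close> and infinite \<open>\<mu>\<close> it is the supremum of the powers of \<open>\<theta>\<close> with
  exponents below \<open>\<mu>\<close>.\<close>

definition weak_power :: "'a rel \<Rightarrow> 'm rel \<Rightarrow> ('m \<times> ('m \<Rightarrow> 'a)) rel" where
  "weak_power \<theta> \<mu> = |SIGMA a : Field \<mu>. underS \<mu> a \<rightarrow>\<^sub>E Field \<theta>|"

definition almost_closed :: "'u rel \<Rightarrow> 'u rel \<Rightarrow> bool" where
  "almost_closed \<mu> \<chi> \<longleftrightarrow> cardinal \<chi> \<and> \<mu> \<le>o \<chi> \<and>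
     (\<forall>\<theta> :: 'u rel. cardinal \<theta> \<and> \<theta> <o \<chi> \<longrightarrow> weak_power \<theta> \<mu> \<le>o \<chi>)"

definition SCH :: "'u rel \<Rightarrow> 'u rel \<Rightarrow> bool" where
  "SCH \<mu> l \<longleftrightarrow> (\<exists>S :: 'u rel set.
     (\<forall>\<chi>\<in>S. cardinal \<chi> \<and> \<mu> \<le>o \<chi> \<and> \<chi> <o l) \<and>
     (\<forall>\<theta> :: 'u rel. cardinal \<theta> \<and> \<theta> <o l \<longrightarrow> (\<exists>\<chi>\<in>S. \<theta> \<le>o \<chi>)) \<and>
     (\<forall>\<chi>\<in>S. almost_closed \<mu> \<chi>))"

definition GCH :: "'u itself \<Rightarrow> bool" where
  "GCH _ \<longleftrightarrow> (\<forall>A :: 'u set. infinite A \<and> small A \<longrightarrow> |Pow A| =o cardSuc |A| )"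


section \<open>Structures in an infinitary vocabulary\<close>

text \<open>The arity of a symbol is an arbitrary set of argument positions; its cardinality is the arity
  in the usual sense. Structures are extensional, so that equality of structures is HOL equality.\<close>

record ('s, 'p) vocabulary =
  Funs :: "'s set"
  Rels :: "'s set"
  arity :: "'s \<Rightarrow> 'p set"

record ('u, 's, 'p) struct =
  univ :: "'u set"
  fint :: "'s \<Rightarrow> ('p \<Rightarrow> 'u) \<Rightarrow> 'u"
  rint :: "'s \<Rightarrow> ('p \<Rightarrow> 'u) set"

definition tuples :: "('s, 'p) vocabulary \<Rightarrow> 's \<Rightarrow> 'u set \<Rightarrow> ('p \<Rightarrow> 'u) set" where
  "tuples \<tau> s U = (arity \<tau> s \<rightarrow>\<^sub>E U)"

definition is_struct :: "('s, 'p) vocabulary \<Rightarrow> ('u, 's, 'p) struct \<Rightarrow> bool" where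
  "is_struct \<tau> M \<longleftrightarrow> small (univ M) \<and>
     fint M \<in> (\<Pi>\<^sub>E s\<in>Funs \<tau>. tuples \<tau> s (univ M) \<rightarrow>\<^sub>E univ M) \<and>
     (\<forall>s\<in>Rels \<tau>. rint M s \<subseteq> tuples \<tau> s (univ M)) \<and>
     (\<forall>s. s \<notin> Rels \<tau> \<longrightarrow> rint M s = {})"

definition substruct ::
  "('s, 'p) vocabulary \<Rightarrow> ('u, 's, 'p) struct \<Rightarrow> ('u, 's, 'p) struct \<Rightarrow> bool" where
  "substruct \<tau> M N \<longleftrightarrow> is_struct \<tau> M \<and> is_struct \<tau> N \<and> univ M \<subseteq> univ N \<and>
     (\<forall>s\<in>Funs \<tau>. \<forall>x\<in>tuples \<tau> s (univ M). fint M s x = fint N s x) \<and>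
     (\<forall>s\<in>Rels \<tau>. rint M s = rint N s \<inter> tuples \<tau> s (univ M))"

definition is_iso ::
  "('s, 'p) vocabulary \<Rightarrow> ('u \<Rightarrow> 'u) \<Rightarrow> ('u, 's, 'p) struct \<Rightarrow> ('u, 's, 'p) struct \<Rightarrow> bool" where
  "is_iso \<tau> f M N \<longleftrightarrow> is_struct \<tau> M \<and> is_struct \<tau> N \<and> bij_betw f (univ M) (univ N) \<and>
     (\<forall>s\<in>Funs \<tau>. \<forall>x\<in>tuples \<tau> s (univ M). f (fint M s x) = fint N s (compose (arity \<tau> s) f x)) \<and>
     (\<forall>s\<in>Rels \<tau>. \<forall>x\<in>tuples \<tau> s (univ M). x \<in> rint M s \<longleftrightarrow> compose (arity \<tau> s) f x \<in> rint N s)"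

text \<open>For directed systems of substructures the choice of \<open>i\<close> below is irrelevant.\<close>

definition union_struct ::
  "('s, 'p) vocabulary \<Rightarrow> 'i set \<Rightarrow> ('i \<Rightarrow> ('u, 's, 'p) struct) \<Rightarrow> ('u, 's, 'p) struct" where
  "union_struct \<tau> I D =
     \<lparr> univ = (\<Union>i\<in>I. univ (D i)),
       fint = (\<lambda>s\<in>Funs \<tau>. \<lambda>x\<in>tuples \<tau> s (\<Union>i\<in>I. univ (D i)).
                 fint (D (SOME i. i \<in> I \<and> x \<in> tuples \<tau> s (univ (D i)))) s x),
       rint = (\<lambda>s. \<Union>i\<in>I. rint (D i) s) \<rparr>"


section \<open>Directed colimits and presentable objects in a category\<close>

text \<open>\<open>Comp C X g f\<close> is the composite of \<open>f\<close> followed by \<open>g\<close>, where \<open>X\<close> is the domain of \<open>f\<close>.\<close>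

record ('o, 'm) category =
  Ob :: "'o set"
  Hom :: "'o \<Rightarrow> 'o \<Rightarrow> 'm set"
  Id :: "'o \<Rightarrow> 'm"
  Comp :: "'o \<Rightarrow> 'm \<Rightarrow> 'm \<Rightarrow> 'm"

definition set_category :: "('x set, 'x \<Rightarrow> 'x) category" where
  "set_category = \<lparr> Ob = UNIV, Hom = (\<lambda>A B. A \<rightarrow>\<^sub>E B), Id = (\<lambda>A. \<lambda>x\<in>A. x), Comp = compose \<rparr>"

definition directed_poset :: "'c rel \<Rightarrow> 'i set \<Rightarrow> 'i rel \<Rightarrow> bool" where
  "directed_poset l I r \<longleftrightarrow> partial_order_on I r \<and>
     (\<forall>A \<subseteq> I. |A| <o l \<longrightarrow> (\<exists>b\<in>I. \<forall>a\<in>A. (a, b) \<in> r))"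

definition diagram ::
  "('o, 'm) category \<Rightarrow> 'i set \<Rightarrow> 'i rel \<Rightarrow> ('i \<Rightarrow> 'o) \<Rightarrow> ('i \<Rightarrow> 'i \<Rightarrow> 'm) \<Rightarrow> bool" where
  "diagram C I r D d \<longleftrightarrow> (\<forall>i\<in>I. D i \<in> Ob C \<and> d i i = Id C (D i)) \<and>
     (\<forall>i\<in>I. \<forall>j\<in>I. (i, j) \<in> r \<longrightarrow> d i j \<in> Hom C (D i) (D j)) \<and>
     (\<forall>i\<in>I. \<forall>j\<in>I. \<forall>k\<in>I. (i, j) \<in> r \<and> (j, k) \<in> r \<longrightarrow> d i k = Comp C (D i) (d j k) (d i j))"

definition cocone ::
  "('o, 'm) category \<Rightarrow> 'i set \<Rightarrow> 'i rel \<Rightarrow> ('i \<Rightarrow> 'o) \<Rightarrow> ('i \<Rightarrow> 'i \<Rightarrow> 'm) \<Rightarrow> 'o \<Rightarrow> ('i \<Rightarrow> 'm) \<Rightarrow> bool"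
where
  "cocone C I r D d X c \<longleftrightarrow> X \<in> Ob C \<and> (\<forall>i\<in>I. c i \<in> Hom C (D i) X) \<and>
     (\<forall>i\<in>I. \<forall>j\<in>I. (i, j) \<in> r \<longrightarrow> Comp C (D i) (c j) (d i j) = c i)"

definition colimit ::
  "('o, 'm) category \<Rightarrow> 'i set \<Rightarrow> 'i rel \<Rightarrow> ('i \<Rightarrow> 'o) \<Rightarrow> ('i \<Rightarrow> 'i \<Rightarrow> 'm) \<Rightarrow> 'o \<Rightarrow> ('i \<Rightarrow> 'm) \<Rightarrow> bool"
where
  "colimit C I r D d X c \<longleftrightarrow> cocone C I r D d X c \<and>
     (\<forall>Y e. cocone C I r D d Y e \<longrightarrow>
        (\<exists>!h. h \<in> Hom C X Y \<and> (\<forall>i\<in>I. Comp C (D i) h (c i) = e i)))"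

text \<open>The action of the covariant hom-functor of \<open>M\<close> on an arrow \<open>f\<close> with domain \<open>X\<close>.\<close>

definition hom_map :: "('o, 'm) category \<Rightarrow> 'o \<Rightarrow> 'o \<Rightarrow> 'm \<Rightarrow> 'm \<Rightarrow> 'm" where
  "hom_map C M X f = (\<lambda>g\<in>Hom C M X. Comp C M f g)"

text \<open>Testing the colimit of the hom-sets against sets of elements of the arrow type only is no
  restriction, since any two-element set is a cogenerator of the category of sets.\<close>

definition presentable :: "('o, 'm) category \<Rightarrow> 'u rel \<Rightarrow> 'o \<Rightarrow> bool" where
  "presentable C l M \<longleftrightarrow> M \<in> Ob C \<and>
     (\<forall>(I :: 'u set) r D d X c.
        small I \<and> directed_poset l I r \<and> diagram C I r D d \<and> colimit C I r D d X c \<longrightarrow>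
        colimit set_category I r
          (\<lambda>i. Hom C M (D i)) (\<lambda>i j. hom_map C M (D i) (d i j))
          (Hom C M X) (\<lambda>i. hom_map C M (D i) (c i)))"

definition is_presentability_rank :: "('o, 'm) category \<Rightarrow> 'o \<Rightarrow> 'u rel \<Rightarrow> bool" where
  "is_presentability_rank C M r \<longleftrightarrow> regular_cardinal r \<and> presentable C r M \<and>
     (\<forall>r' :: 'u rel. regular_cardinal r' \<and> presentable C r' M \<longrightarrow> r \<le>o r')"

definition is_internal_size :: "('o, 'm) category \<Rightarrow> 'o \<Rightarrow> 'u rel \<Rightarrow> bool" where
  "is_internal_size C M \<chi> \<longleftrightarrow> cardinal \<chi> \<and>
     (\<exists>r :: 'u rel. is_presentability_rank C M r \<and>
        (r =o cardSuc \<chi> \<or> limit_cardinal r \<and> r =o \<chi>))"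


section \<open>Abstract elementary classes of infinitary arity\<close>

record ('u, 's, 'p) aclass =
  voc :: "('s, 'p) vocabulary"
  models :: "('u, 's, 'p) struct set"
  le :: "('u, 's, 'p) struct rel"

definition abstract_class :: "'u rel \<Rightarrow> ('u, 's, 'p) aclass \<Rightarrow> bool" where
  "abstract_class \<mu> K \<longleftrightarrow>
     Funs (voc K) \<inter> Rels (voc K) = {} \<and>
     (\<forall>s\<in>Funs (voc K) \<union> Rels (voc K). |arity (voc K) s| <o \<mu>) \<and>
     (\<forall>M\<in>models K. is_struct (voc K) M) \<and>
     partial_order_on (models K) (le K) \<and>
     (\<forall>M N f. M \<in> models K \<and> is_iso (voc K) f M N \<longrightarrow> N \<in> models K) \<and>
     (\<forall>M N M' N' f. (M, N) \<in> le K \<and> is_iso (voc K) f N N' \<and> is_iso (voc K) f M M'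
        \<longrightarrow> (M', N') \<in> le K) \<and>
     (\<forall>M N. (M, N) \<in> le K \<longrightarrow> substruct (voc K) M N)"

definition K_embeddings ::
  "('u, 's, 'p) aclass \<Rightarrow> ('u, 's, 'p) struct \<Rightarrow> ('u, 's, 'p) struct \<Rightarrow> ('u \<Rightarrow> 'u) set" where
  "K_embeddings K M N =
     {f \<in> extensional (univ M). \<exists>M'. is_iso (voc K) f M M' \<and> (M', N) \<in> le K}"

definition cat_of :: "('u, 's, 'p) aclass \<Rightarrow> (('u, 's, 'p) struct, 'u \<Rightarrow> 'u) category" where
  "cat_of K = \<lparr> Ob = models K, Hom = K_embeddings K,
     Id = (\<lambda>M. \<lambda>x\<in>univ M. x), Comp = (\<lambda>M. compose (univ M)) \<rparr>"

definition coherent :: "('u, 's, 'p) aclass \<Rightarrow> bool" where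
  "coherent K \<longleftrightarrow> (\<forall>M0\<in>models K. \<forall>M1\<in>models K. \<forall>M2\<in>models K.
     substruct (voc K) M0 M1 \<and> (M1, M2) \<in> le K \<and> (M0, M2) \<in> le K \<longrightarrow> (M0, M1) \<in> le K)"

text \<open>If the cardinality of \<open>'u\<close> is regular, smallness of the union is automatic.\<close>

definition chain_axioms :: "'u rel \<Rightarrow> ('u, 's, 'p) aclass \<Rightarrow> bool" where
  "chain_axioms \<mu> K \<longleftrightarrow> (\<forall>(I :: 'u set) r D.
     small I \<and> directed_poset \<mu> I r \<and> (\<forall>i\<in>I. D i \<in> models K) \<and>
     (\<forall>i\<in>I. \<forall>j\<in>I. (i, j) \<in> r \<longrightarrow> (D i, D j) \<in> le K) \<and> small (\<Union>i\<in>I. univ (D i)) \<longrightarrow>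
     union_struct (voc K) I D \<in> models K \<and>
     (\<forall>i\<in>I. (D i, union_struct (voc K) I D) \<in> le K) \<and>
     (\<forall>N\<in>models K. (\<forall>i\<in>I. (D i, N) \<in> le K) \<longrightarrow> (union_struct (voc K) I D, N) \<in> le K))"

definition LST_cardinal :: "'u rel \<Rightarrow> ('u, 's, 'p) aclass \<Rightarrow> 'u rel \<Rightarrow> bool" where
  "LST_cardinal \<mu> K l \<longleftrightarrow> cardinal l \<and> l =o weak_power l \<mu> \<and>
     |Funs (voc K) \<union> Rels (voc K)| +c \<mu> \<le>o l \<and>
     (\<forall>M\<in>models K. \<forall>A \<subseteq> univ M. \<exists>M0. (M0, M) \<in> le K \<and> A \<subseteq> univ M0 \<and>
        |univ M0| \<le>o weak_power |A| \<mu> +c l)"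

definition mu_AEC :: "'u rel \<Rightarrow> ('u, 's, 'p) aclass \<Rightarrow> bool" where
  "mu_AEC \<mu> K \<longleftrightarrow> regular_cardinal \<mu> \<and> abstract_class \<mu> K \<and> coherent K \<and> chain_axioms \<mu> K \<and>
     (\<exists>l :: 'u rel. LST_cardinal \<mu> K l)"

definition is_LS :: "'u rel \<Rightarrow> ('u, 's, 'p) aclass \<Rightarrow> 'u rel \<Rightarrow> bool" where
  "is_LS \<mu> K l \<longleftrightarrow> LST_cardinal \<mu> K l \<and> (\<forall>l' :: 'u rel. LST_cardinal \<mu> K l' \<longrightarrow> l \<le>o l')"

end

theory Submission
  imports Defs
begin

text \<open>
  Let \<open>\<kappa>\<close> be the size of \<open>M\<close>. The colimit of a \<open>\<mu>\<close>-directed diagram is the union of the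
  images of its objects, so that, by coherence, a map out of a structure with fewer than \<open>l\<close>
  elements into the colimit of an \<open>l\<close>-directed diagram factors through one of the objects. Hence
  \<open>M\<close> is presentable at the successor of \<open>\<kappa>\<close>. Conversely, let \<open>l \<le> \<kappa>\<close> be regular with
  \<open>LS < l\<close> and such that \<open>\<theta>\<close> to the power \<open><\<mu>\<close> is less than \<open>l\<close> for all \<open>\<theta> < l\<close>. Then the
  submodels of \<open>M\<close> with fewer than \<open>l\<close> elements form an \<open>l\<close>-directed diagram with colimit \<open>M\<close>,
  and the identity of \<open>M\<close> does not factor through any of them, so \<open>M\<close> is not \<open>l\<close>-presentable.
  To exclude a regular cardinal \<open>r\<close> as presentability rank, take \<open>l = \<kappa>\<close> if \<open>r = \<kappa>\<close>, and otherwise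
  the successor of \<open>r + LS\<close> to the power \<open><\<mu>\<close>.
\<close>

section \<open>Cardinal arithmetic\<close>

lemma card_of_PiE: "|X \<rightarrow>\<^sub>E A| = |A| ^c |X|"
proof -
  have "X \<rightarrow>\<^sub>E A = Func X A"
    by (auto simp: Func_def PiE_def extensional_def)
  then show ?thesis by (simp add: cexp_def Field_card_of)
qed

lemma finite_ordLess_Cinfinite:
  assumes "finite A" "Cinfinite r"
  shows "|A| <o r"
  by (rule Cfinite_ordLess_Cinfinite[OF _ assms(2)])
    (simp add: cfinite_def Field_card_of card_of_card_order_on assms(1))

lemma card_of_Field_eq: "Card_order r \<Longrightarrow> |Field r| \<le>o r" "Card_order r \<Longrightarrow> r \<le>o |Field r|"
  using card_of_Field_ordIso[of r] by (simp_all add: ordIso_iff_ordLeq)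

lemma ordLess_or_ordLeq_Card: "Card_order r \<Longrightarrow> Card_order s \<Longrightarrow> r <o s \<or> s \<le>o r"
  by (intro ordLess_or_ordLeq card_order_on_well_order_on)

section \<open>Sequences of length below \<mu>\<close>

lemma Card_order_weak_power: "Card_order (weak_power \<theta> \<mu>)"
  unfolding weak_power_def by (rule card_of_Card_order)

lemma weak_power_mono:
  assumes "|Field \<theta>| \<le>o |Field \<theta>'|"
  shows "weak_power \<theta> \<mu> \<le>o weak_power \<theta>' \<mu>"
  unfolding weak_power_def
  by (rule card_of_Sigma_mono1) (simp add: card_of_PiE cexp_mono1 assms card_of_Card_order)

lemma weak_power_least:
  assumes "Cinfinite \<kappa>" "Card_order \<mu>" "\<mu> \<le>o \<kappa>"
    and "\<And>a. a \<in> Field \<mu> \<Longrightarrow> |underS \<mu> a \<rightarrow>\<^sub>E Field \<theta>| \<le>o \<kappa>"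
  shows "weak_power \<theta> \<mu> \<le>o \<kappa>"
  unfolding weak_power_def
  using assms(1,4) ordLeq_transitive[OF card_of_Field_eq(1)[OF assms(2)] assms(3)]
  by (intro card_of_Sigma_ordLeq_infinite_Field) (simp_all add: cinfinite_def)

text \<open>A set smaller than \<mu> is equinumerous with a proper initial segment
  \<open>underS \<mu> a\<close>, and the functions on that segment form one summand of the weak
  power.\<close>

lemma PiE_le_weak_power:
  assumes \<mu>: "Card_order \<mu>" and X: "|X| <o \<mu>"
  shows "|X \<rightarrow>\<^sub>E Field \<theta>| \<le>o weak_power \<theta> \<mu>"
proof -
  have W: "Well_order \<mu>" using \<mu> by (rule card_order_on_well_order_on)
  then obtain a where a: "a \<in> Field \<mu>" "|X| =o Restr \<mu> (underS \<mu> a)"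
    using X unfolding ordLess_iff_ordIso_Restr[OF W card_of_Well_order] by (elim bexE)
  have "Refl \<mu>" using W by (simp add: order_on_defs)
  moreover have "underS \<mu> a \<subseteq> Field \<mu>" by (rule Order_Relation.underS_Field)
  ultimately have "Field (Restr \<mu> (underS \<mu> a)) = underS \<mu> a" by (rule Refl_Field_Restr2)
  then have "|X| =o |underS \<mu> a|" using card_of_cong[OF a(2)] by (simp add: Field_card_of)
  then have "|X \<rightarrow>\<^sub>E Field \<theta>| =o |underS \<mu> a \<rightarrow>\<^sub>E Field \<theta>|"
    unfolding card_of_PiE by (rule cexp_cong2) (rule card_of_Card_order)+
  also have "|underS \<mu> a \<rightarrow>\<^sub>E Field \<theta>| \<le>o weak_power \<theta> \<mu>"
    unfolding weak_power_def
    by (rule card_of_ordLeqI[of "Pair a"]) (use a in \<open>auto simp: inj_on_def\<close>)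
  finally show ?thesis .
qed

lemma Card_order_total:
  assumes "Card_order r" "x \<in> Field r" "y \<in> Field r"
  shows "(x, y) \<in> r \<or> (y, x) \<in> r"
proof -
  have "Well_order r" using assms(1) by (rule card_order_on_well_order_on)
  then have "Total r" "Refl r" by (auto simp: order_on_defs)
  then show ?thesis using assms(2,3) by (cases "x = y") (auto simp: total_on_def refl_on_def)
qed

text \<open>Failure of strict cofinality yields only an \<open>a\<close> that no element of
  \<open>K\<close> exceeds. An infinite cardinal has no greatest element, so some \<open>b\<close>
  beyond \<open>a\<close> bounds \<open>K\<close> strictly.\<close>

lemma not_cofinal_bound:
  assumes r: "Cinfinite r" and K: "K \<subseteq> Field r" "\<not> cofinal K r"
  shows "\<exists>b\<in>Field r. K \<subseteq> underS r b"
proof -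
  obtain a where a: "a \<in> Field r" "\<And>k. k \<in> K \<Longrightarrow> a = k \<or> (a, k) \<notin> r"
    using K(2) unfolding cofinal_def by blast
  obtain b where b: "b \<in> Field r" "a \<noteq> b" "(a, b) \<in> r"
    using infinite_Card_order_limit[of r a] r a(1) unfolding cinfinite_def by blast
  have "Well_order r" using r by (intro card_order_on_well_order_on) simp
  then have tr: "trans r" and an: "antisym r" by (auto simp: order_on_defs)
  have "k \<in> underS r b" if k: "k \<in> K" for k
  proof -
    have "(k, a) \<in> r" using Card_order_total[of r a k] r a k K(1) by blast
    then have "(k, b) \<in> r" "k \<noteq> b" using tr an b by (auto dest: transD antisymD)
    then show ?thesis by (simp add: underS_def)
  qed
  then show ?thesis using b(1) by blast
qed

lemma underS_Card_order_nonempty: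
  assumes "Cinfinite \<mu>"
  shows "\<exists>a\<in>Field \<mu>. underS \<mu> a \<noteq> {}"
proof -
  have "Field \<mu> \<noteq> {}" using assms by (auto simp: cinfinite_def)
  then obtain b where "b \<in> Field \<mu>" by blast
  moreover then obtain a where "a \<in> Field \<mu>" "b \<noteq> a" "(b, a) \<in> \<mu>"
    using infinite_Card_order_limit[of \<mu> b] assms unfolding cinfinite_def by blast
  ultimately have "b \<in> underS \<mu> a" by (simp add: underS_def)
  then show ?thesis using \<open>a \<in> Field \<mu>\<close> by blast
qed

lemma le_weak_power:
  assumes \<mu>: "Cinfinite \<mu>" and \<theta>: "Card_order \<theta>"
  shows "\<theta> \<le>o weak_power \<theta> \<mu>" and "Field \<theta> \<noteq> {} \<Longrightarrow> \<mu> \<le>o weak_power \<theta> \<mu>"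
proof -
  obtain a p where a: "a \<in> Field \<mu>" "p \<in> underS \<mu> a"
    using underS_Card_order_nonempty[OF \<mu>] by blast
  \<comment> \<open>Constant sequences of one fixed length. That length is nonzero, so distinct
    values give distinct sequences.\<close>
  have "inj_on (\<lambda>x. (a, \<lambda>_\<in>underS \<mu> a. x)) (Field \<theta>)"
    by (rule inj_onI) (use a in \<open>auto simp: fun_eq_iff split: if_splits\<close>)
  then have "|Field \<theta>| \<le>o weak_power \<theta> \<mu>"
    unfolding weak_power_def by (rule card_of_ordLeqI) (use a in auto)
  with card_of_Field_eq(2)[OF \<theta>] show "\<theta> \<le>o weak_power \<theta> \<mu>" by (rule ordLeq_transitive)
  assume "Field \<theta> \<noteq> {}"
  then obtain x where x: "x \<in> Field \<theta>" by blast
  \<comment> \<open>Now the value is fixed and the length varies.\<close>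
  have "inj_on (\<lambda>a. (a, \<lambda>_\<in>underS \<mu> a. x)) (Field \<mu>)"
    by (rule inj_onI) auto
  then have "|Field \<mu>| \<le>o weak_power \<theta> \<mu>"
    unfolding weak_power_def by (rule card_of_ordLeqI) (use x in auto)
  with card_of_Field_eq(2)[OF conjunct2[OF \<mu>]] show "\<mu> \<le>o weak_power \<theta> \<mu>" by (rule ordLeq_transitive)
qed

text \<open>The product is compared with the disjoint sum, which stays below \<mu> and dominates
  both factors. Absorption requires an infinite sum, so two finite factors are treated
  apart.\<close>

lemma card_of_ordLess_Times:
  assumes "Cinfinite \<mu>" "|X| <o \<mu>" "|Y| <o \<mu>"
  shows "|X \<times> Y| <o \<mu>"
proof (cases "finite X \<and> finite Y")
  case True
  then show ?thesis using assms(1)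
    by (intro finite_ordLess_Cinfinite) simp_all
next
  case False
  have U: "|X <+> Y| <o \<mu>"
    using assms by (intro card_of_Plus_ordLess_infinite_Field) (simp_all add: cinfinite_def)
  have "infinite (X <+> Y)" using False by simp
  then have "|X \<times> Y| \<le>o |X <+> Y|"
    using card_of_Plus1[of X Y] card_of_Plus2[of Y X]
    by (intro card_of_Times_ordLeq_infinite_Field) (simp_all add: Field_card_of card_of_card_order_on)
  then show ?thesis using U by (rule ordLeq_ordLess_trans)
qed

text \<open>By regularity of \<open>\<mu>\<close>, the lengths of fewer than \<open>\<mu>\<close> short sequences have a bound \<open>b\<close> below
  \<open>\<mu>\<close>.\<close>

lemma weak_power_idem:
  assumes \<mu>: "Cinfinite \<mu>" "regularCard \<mu>" and A: "infinite A"
  shows "weak_power (weak_power |A| \<mu>) \<mu> \<le>o weak_power |A| \<mu>"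
proof -
  \<comment> \<open>\<open>w B\<close> consists of the sequences in \<open>A\<close> with length in
    \<open>B\<close>, so the weak power is the cardinality of \<open>W\<close>.\<close>
  define w where "w = (\<lambda>B. SIGMA a : B. underS \<mu> a \<rightarrow>\<^sub>E A)"
  define W where "W = w (Field \<mu>)"
  have W: "weak_power |A| \<mu> = |W|" by (simp add: weak_power_def W_def w_def Field_card_of)
  have A2: "Cinfinite |A|" using A by (simp add: cinfinite_def Field_card_of card_of_card_order_on)
  have AW: "|A| \<le>o |W|" using le_weak_power(1)[OF \<mu>(1) card_of_Card_order[of A]] W by simp
  then have Winf: "infinite W" using A by (rule card_of_ordLeq_infinite)
  have "\<mu> \<le>o |W|"
    using le_weak_power(2)[OF \<mu>(1) card_of_Card_order[of A]] A W by (auto simp: Field_card_of)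
  have \<mu>W: "|Field \<mu>| \<le>o |W|"
    using card_of_Field_eq(1)[OF conjunct2[OF \<mu>(1)]] \<open>\<mu> \<le>o |W|\<close> by (rule ordLeq_transitive)
  \<comment> \<open>The number of lengths below \<open>b\<close> is |b|, which is at most |A| to the
    power |b|, and each length contributes at most that many sequences.\<close>
  have bounded: "|w (underS \<mu> b)| \<le>o |A| ^c |underS \<mu> b|" for b
  proof (cases "underS \<mu> b = {}")
    case True
    then show ?thesis by (simp add: w_def Card_order_empty Card_order_cexp)
  next
    case False
    have ne: "Cnotzero |underS \<mu> b|"
      using False by (simp add: card_of_ordIso_czero_iff_empty card_of_Card_order)
    have "|A| \<le>o |A| ^c |underS \<mu> b|" by (rule ordLeq_cexp1[OF ne conjunct2[OF A2]])
    then have inf: "Cinfinite ( |A| ^c |underS \<mu> b| )"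
      using cinfinite_mono[of "|A|" "|A| ^c |underS \<mu> b|"] A2
        Card_order_cexp[of "|A|" "|underS \<mu> b|"] by metis
    have "|underS \<mu> c \<rightarrow>\<^sub>E A| \<le>o |A| ^c |underS \<mu> b|" if c: "c \<in> underS \<mu> b" for c
    \<comment> \<open>Monotonicity in the exponent is applied to nonzero exponents only; at length
      zero there is a single function.\<close>
    proof (cases "underS \<mu> c = {}")
      case True
      then have "finite (underS \<mu> c \<rightarrow>\<^sub>E A)" by simp
      then show ?thesis
        using inf by (intro ordLess_imp_ordLeq finite_ordLess_Cinfinite)
    next
      case False
      have "Well_order \<mu>" using \<mu>(1) by (intro card_order_on_well_order_on) simp
      then have "trans \<mu>" "antisym \<mu>" by (auto simp: order_on_defs)
      then have "underS \<mu> c \<subseteq> underS \<mu> b"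
        using c unfolding underS_def by (auto dest: transD antisymD)
      then show ?thesis
        unfolding card_of_PiE using False
        by (intro cexp_mono2_Cnotzero card_of_mono1)
          (simp_all add: card_of_ordIso_czero_iff_empty card_of_Card_order)
    qed
    moreover have "|underS \<mu> b| \<le>o |A| ^c |underS \<mu> b|"
      by (rule ordLeq_cexp2[OF ctwo_ordLeq_Cinfinite[OF A2] card_of_Card_order])
    ultimately show ?thesis
      unfolding w_def using inf
      by (intro card_of_Sigma_ordLeq_infinite_Field) (simp_all add: cinfinite_def)
  qed
  have "|underS \<mu> a \<rightarrow>\<^sub>E W| \<le>o |W|" if a: "a \<in> Field \<mu>" for a
  proof -
    have "underS \<mu> a \<rightarrow>\<^sub>E W \<subseteq> (\<Union>b\<in>Field \<mu>. underS \<mu> a \<rightarrow>\<^sub>E w (underS \<mu> b))"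
    proof
      fix F assume F: "F \<in> underS \<mu> a \<rightarrow>\<^sub>E W"
      \<comment> \<open>The lengths of the entries of \<open>F\<close>. There are fewer than \<mu>
        of them, so regularity keeps them from being cofinal.\<close>
      let ?K = "(\<lambda>x. fst (F x)) ` underS \<mu> a"
      have "fst (F x) \<in> Field \<mu>" if "x \<in> underS \<mu> a" for x
        using PiE_mem[OF F that] by (auto simp: W_def w_def)
      then have K: "?K \<subseteq> Field \<mu>" by blast
      have "|?K| <o \<mu>"
        by (rule ordLeq_ordLess_trans[OF card_of_image card_of_underS[OF conjunct2[OF \<mu>(1)] a]])
      then have "\<not> cofinal ?K \<mu>"
        using K \<mu>(2) not_ordLess_ordIso[of "|?K|" \<mu>] unfolding regularCard_def by blast
      then obtain b where b: "b \<in> Field \<mu>" "?K \<subseteq> underS \<mu> b"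
        using not_cofinal_bound[OF \<mu>(1) K] by blast
      have "F x \<in> w (underS \<mu> b)" if "x \<in> underS \<mu> a" for x
      proof -
        have "F x \<in> W" "fst (F x) \<in> underS \<mu> b" using F b(2) that by auto
        then show ?thesis by (cases "F x") (simp add: W_def w_def)
      qed
      then have "F \<in> underS \<mu> a \<rightarrow>\<^sub>E w (underS \<mu> b)" using F by (simp add: PiE_iff)
      then show "F \<in> (\<Union>b\<in>Field \<mu>. underS \<mu> a \<rightarrow>\<^sub>E w (underS \<mu> b))" using b(1) by blast
    qed
    then have "|underS \<mu> a \<rightarrow>\<^sub>E W| \<le>o |\<Union>b\<in>Field \<mu>. underS \<mu> a \<rightarrow>\<^sub>E w (underS \<mu> b)|"
      by (rule card_of_mono1)
    also have "|\<Union>b\<in>Field \<mu>. underS \<mu> a \<rightarrow>\<^sub>E w (underS \<mu> b)| \<le>o |W|"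
    proof (rule card_of_UNION_ordLeq_infinite[OF Winf \<mu>W], rule ballI)
      fix b assume b: "b \<in> Field \<mu>"
      \<comment> \<open>By currying, a sequence of \<open>a\<close> many sequences shorter than
        \<open>b\<close> costs no more than one function on the product of the two segments, which
        is still smaller than \<mu>.\<close>
      have "|underS \<mu> a \<rightarrow>\<^sub>E w (underS \<mu> b)| \<le>o ( |A| ^c |underS \<mu> b| ) ^c |underS \<mu> a|"
        unfolding card_of_PiE by (rule cexp_mono1[OF bounded card_of_Card_order])
      also have "( |A| ^c |underS \<mu> b| ) ^c |underS \<mu> a| =o |A| ^c ( |underS \<mu> b| *c |underS \<mu> a| )"
        by (rule cexp_cprod[OF card_of_Card_order])
      also have "|A| ^c ( |underS \<mu> b| *c |underS \<mu> a| ) = |underS \<mu> b \<times> underS \<mu> a \<rightarrow>\<^sub>E A|"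
        by (simp add: card_of_PiE cprod_def Field_card_of)
      also have "|underS \<mu> b \<times> underS \<mu> a \<rightarrow>\<^sub>E A| \<le>o |W|"
        using PiE_le_weak_power[of \<mu> "underS \<mu> b \<times> underS \<mu> a" "|A|"] \<mu>(1) W
          card_of_ordLess_Times[OF \<mu>(1) card_of_underS card_of_underS] a b
        by (simp add: Field_card_of)
      finally show "|underS \<mu> a \<rightarrow>\<^sub>E w (underS \<mu> b)| \<le>o |W|" .
    qed
    finally show ?thesis .
  qed
  then have "weak_power |W| \<mu> \<le>o |W|"
    using Winf \<mu>(1) \<open>\<mu> \<le>o |W|\<close>
    by (intro weak_power_least) (simp_all add: cinfinite_def Field_card_of card_of_card_order_on)
  then show ?thesis by (simp only: W)
qed

section \<open>Almost closed cardinals under GCH\<close>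

lemma card_of_PiE_le_Pow:
  assumes "infinite C" "X \<subseteq> C" "Y \<subseteq> C"
  shows "|X \<rightarrow>\<^sub>E Y| \<le>o |Pow C|"
proof -
  have Pow: "|Pow D| =o ctwo ^c |D|" for D :: "'z set"
    using card_of_Pow_Func[of D] by (simp add: cexp_def ctwo_def Field_card_of)
  \<comment> \<open>A function is coded by its graph, a subset of \<open>C \<times> C\<close>, and
    an infinite \<open>C\<close> absorbs the square.\<close>
  have "inj_on (\<lambda>f. (\<lambda>x. (x, f x)) ` X) (X \<rightarrow>\<^sub>E Y)"
  proof (rule inj_onI)
    fix f g assume f: "f \<in> X \<rightarrow>\<^sub>E Y" and g: "g \<in> X \<rightarrow>\<^sub>E Y"
      and eq: "(\<lambda>x. (x, f x)) ` X = (\<lambda>x. (x, g x)) ` X"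
    show "f = g"
    proof (rule PiE_ext[OF f g])
      fix x assume "x \<in> X"
      then have "(x, f x) \<in> (\<lambda>x. (x, g x)) ` X" unfolding eq[symmetric] by blast
      then show "f x = g x" by auto
    qed
  qed
  then have "|X \<rightarrow>\<^sub>E Y| \<le>o |Pow (C \<times> C)|"
    by (rule card_of_ordLeqI) (use assms in auto)
  also have "|Pow (C \<times> C)| =o ctwo ^c |C \<times> C|" by (rule Pow)
  also have "ctwo ^c |C \<times> C| =o ctwo ^c |C|"
    by (rule cexp_cong2[OF card_of_Times_same_infinite[OF assms(1)] Card_order_ctwo card_of_Card_order])
  also have "ctwo ^c |C| =o |Pow C|" using Pow by (rule ordIso_symmetric)
  finally show ?thesis .
qed

text \<open>The length and the base of a power are joined into one set \<open>?C\<close> smaller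
  than \<chi>. The functions number at most 2 to the power |C|, which under GCH is the successor of
  |C| and hence at most \<chi>. GCH speaks of infinite sets, so a finite \<open>?C\<close> is
  handled separately.\<close>

lemma GCH_almost_closed:
  fixes \<mu> \<chi> :: "'u rel"
  assumes gch: "GCH TYPE('u)" and \<mu>: "Cinfinite \<mu>" and \<chi>: "cardinal \<chi>" "\<mu> \<le>o \<chi>"
  shows "almost_closed \<mu> \<chi>"
  unfolding almost_closed_def
proof (intro conjI allI impI \<chi>)
  fix \<theta> :: "'u rel" assume \<theta>: "cardinal \<theta> \<and> \<theta> <o \<chi>"
  have \<chi>inf: "Cinfinite \<chi>"
    using \<chi> \<mu> cinfinite_mono[OF \<chi>(2)] unfolding cardinal_def by simp
  show "weak_power \<theta> \<mu> \<le>o \<chi>"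
  proof (rule weak_power_least[OF \<chi>inf _ \<chi>(2)])
    show "Card_order \<mu>" using \<mu> by blast
    fix a assume a: "a \<in> Field \<mu>"
    let ?C = "underS \<mu> a \<union> Field \<theta>"
    show "|underS \<mu> a \<rightarrow>\<^sub>E Field \<theta>| \<le>o \<chi>"
    proof (cases "finite ?C")
      case True
      then have "finite (underS \<mu> a \<rightarrow>\<^sub>E Field \<theta>)" by (simp add: finite_PiE)
      then show ?thesis
        using \<chi>inf by (intro ordLess_imp_ordLeq finite_ordLess_Cinfinite)
    next
      case False
      have "|underS \<mu> a| <o \<chi>"
        by (rule ordLess_ordLeq_trans[OF card_of_underS[OF conjunct2[OF \<mu>] a] \<chi>(2)])
      then have C: "|?C| <o \<chi>"
        by (rule Un_Cinfinite_bound_strict[OF _ BNF_Cardinal_Order_Relation.ordLess_Field[OF conjunct2[OF \<theta>]] \<chi>inf])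
      moreover have "|Field \<chi>| <o |UNIV :: 'u set|" using \<chi>(1) by (simp add: cardinal_def small_def)
      ultimately have "small ?C"
        unfolding small_def
        using ordLess_transitive[OF ordLess_ordLeq_trans[OF C card_of_Field_eq(2)[OF conjunct2[OF \<chi>inf]]]] by blast
      then have Pow: "|Pow ?C| =o cardSuc |?C|" using gch False unfolding GCH_def by blast
      have suc: "cardSuc |?C| \<le>o \<chi>"
        using C \<chi>inf by (intro cardSuc_least card_of_Card_order) simp
      have "|underS \<mu> a \<rightarrow>\<^sub>E Field \<theta>| \<le>o |Pow ?C|"
        using False by (intro card_of_PiE_le_Pow) auto
      then show ?thesis by (rule ordLeq_transitive[OF ordLeq_ordIso_trans[OF _ Pow] suc])
    qed
  qed
qed

lemma GCH_imp_SCH: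
  fixes \<mu> l :: "'u rel"
  assumes "GCH TYPE('u)" "regular_cardinal \<mu>" "\<mu> <o l"
  shows "SCH \<mu> l"
proof -
  \<comment> \<open>Under GCH every cardinal in the interval from \<mu> up to \<open>l\<close>
    qualifies.\<close>
  let ?S = "{\<chi> :: 'u rel. cardinal \<chi> \<and> \<mu> \<le>o \<chi> \<and> \<chi> <o l}"
  have \<mu>: "cardinal \<mu>" "Cinfinite \<mu>" using assms(2) by (auto simp: regular_cardinal_def cardinal_def)
  have "\<exists>\<chi>\<in>?S. \<theta> \<le>o \<chi>" if "cardinal \<theta> \<and> \<theta> <o l" for \<theta> :: "'u rel"
  proof (cases "\<mu> \<le>o \<theta>")
    case True
    then have "\<theta> \<in> ?S" using that by simp
    then show ?thesis using that ordLeq_refl[of \<theta>] by (intro bexI[of _ \<theta>]) (simp_all add: cardinal_def)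
  next
    \<comment> \<open>A cardinal below the interval is dominated by its least element \<mu>.\<close>
    case False
    then have "\<theta> \<le>o \<mu>"
      using that \<mu>(2) ordLess_or_ordLeq_Card[of \<theta> \<mu>] ordLess_imp_ordLeq[of \<theta> \<mu>]
      unfolding cardinal_def by metis
    moreover have "\<mu> \<in> ?S" using \<mu> assms(3) ordLeq_refl[of \<mu>] by simp
    ultimately show ?thesis by (rule bexI)
  qed
  moreover have "\<forall>\<chi>\<in>?S. almost_closed \<mu> \<chi>" using GCH_almost_closed[OF assms(1) \<mu>(2)] by blast
  ultimately show ?thesis unfolding SCH_def by (intro exI[of _ ?S]) simp
qed

section \<open>Powers of cardinals below the size of the model\<close>

lemma cardinal_card_of_subset:
  assumes "small B" "A \<subseteq> B"
  shows "cardinal |A|"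
  using assms(1) ordLeq_ordLess_trans[OF card_of_mono1[OF assms(2)]]
  unfolding cardinal_def small_def by (simp add: Field_card_of card_of_card_order_on)

text \<open>\<open>cardSuc\<close> and \<open>weak_power\<close> yield orders on types other than
  \<open>'u\<close>. Realising such a cardinal by a subset of \<open>B\<close> makes it available
  where a cardinal on \<open>'u\<close> is demanded.\<close>

lemma ordLeq_card_of_subset:
  assumes "Card_order r" "r \<le>o |B|"
  shows "\<exists>A. A \<subseteq> B \<and> |A| =o r"
proof -
  have "|Field r| \<le>o |B|" using card_of_Field_eq(1)[OF assms(1)] assms(2) by (rule ordLeq_transitive)
  then have "\<exists>A \<subseteq> B. |Field r| =o |A| \<and> |A| \<le>o |B|"
    by (rule iffD1[OF internalize_card_of_ordLeq2])
  then obtain A where A: "A \<subseteq> B" "|Field r| =o |A|" by (elim exE conjE)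
  then show ?thesis
    using ordIso_transitive[OF ordIso_symmetric[OF A(2)] card_of_Field_ordIso[OF assms(1)]]
    by (intro exI conjI)
qed

text \<open>Almost closure of \<chi> controls only bases strictly below \<chi>. Since |B| is not a
  successor, the successor of |A| is still below |B|; an almost closed \<chi> between these two lies
  strictly above |A|.\<close>

lemma closed_below_limit:
  fixes B :: "'u set"
  assumes B: "small B" and sch: "SCH \<mu> |B|"
    and lim: "\<not> (\<exists>l0 :: 'u rel. cardinal l0 \<and> |B| =o cardSuc l0)"
    and A: "A \<subseteq> B" "|A| <o |B|"
  shows "weak_power |A| \<mu> <o |B|"
proof -
  have cA: "cardinal |A|" using B A(1) by (rule cardinal_card_of_subset)
  have sA: "Card_order (cardSuc |A| )" by (simp add: cardSuc_Card_order card_of_Card_order)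
  have "cardSuc |A| \<le>o |B|" by (rule cardSuc_least[OF card_of_Card_order card_of_Card_order A(2)])
  then have less: "cardSuc |A| <o |B|"
    using lim cA ordIso_symmetric[of "cardSuc |A|" "|B|"]
    unfolding ordLeq_iff_ordLess_or_ordIso by metis
  obtain C where C: "C \<subseteq> B" "|C| =o cardSuc |A|"
    using ordLeq_card_of_subset[OF sA ordLess_imp_ordLeq[OF less]] by (elim exE conjE)
  have "cardinal |C|" "|C| <o |B|"
    using cardinal_card_of_subset[OF B C(1)] ordIso_ordLess_trans[OF C(2) less] by auto
  then obtain \<chi> where \<chi>: "|C| \<le>o \<chi>" "\<chi> <o |B|" "almost_closed \<mu> \<chi>"
    using sch unfolding SCH_def by blast
  have "|A| <o |C|"
    using cardSuc_greater[OF card_of_Card_order] ordIso_symmetric[OF C(2)] by (rule ordLess_ordIso_trans)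
  then have "|A| <o \<chi>" using \<chi>(1) by (rule ordLess_ordLeq_trans)
  then have "weak_power |A| \<mu> \<le>o \<chi>" using \<chi>(3) cA unfolding almost_closed_def by blast
  then show ?thesis using \<chi>(2) by (rule ordLeq_ordLess_trans)
qed

text \<open>Unboundedness below the successor of \<open>l0\<close> forces an almost closed cardinal
  that is at least \<open>l0\<close> and less than its successor, hence equinumerous with
  \<open>l0\<close>.\<close>

lemma SCH_successor:
  fixes \<mu> l0 :: "'u rel"
  assumes sch: "SCH \<mu> l" and l0: "cardinal l0" and l: "l =o cardSuc l0"
  shows "almost_closed \<mu> l0"
proof -
  have Cl0: "Card_order l0" using l0 by (simp add: cardinal_def)
  have "l0 <o l" using cardSuc_greater[OF Cl0] ordIso_symmetric[OF l] by (rule ordLess_ordIso_trans)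
  then obtain \<chi> where \<chi>: "l0 \<le>o \<chi>" "\<chi> <o l" "almost_closed \<mu> \<chi>"
    using sch l0 unfolding SCH_def by blast
  have less: "\<chi> <o cardSuc l0" using \<chi>(2) l by (rule ordLess_ordIso_trans)
  have "Card_order \<chi>" using \<chi>(3) by (simp add: almost_closed_def cardinal_def)
  then have "\<chi> \<le>o l0" using less by (rule iffD1[OF cardSuc_ordLeq_ordLess[OF Cl0]])
  note le = ordLeq_transitive[OF _ this]
  show ?thesis
    unfolding almost_closed_def
  proof (intro conjI allI impI l0)
    show "\<mu> \<le>o l0" by (rule le) (use \<chi>(3) in \<open>simp add: almost_closed_def\<close>)
    fix \<theta> :: "'u rel" assume \<theta>: "cardinal \<theta> \<and> \<theta> <o l0"
    have "\<theta> <o \<chi>" by (rule ordLess_ordLeq_trans[OF conjunct2[OF \<theta>] \<chi>(1)])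
    then show "weak_power \<theta> \<mu> \<le>o l0"
      by (intro le) (use \<chi>(3) \<theta> in \<open>simp add: almost_closed_def\<close>)
  qed
qed

text \<open>Justifies the choice in the definition of \<open>cofinality\<close>: without a greatest
  element the whole field is strictly cofinal, and cardinals are well-ordered.\<close>

lemma cofinality_props:
  assumes "Cinfinite r"
  shows "\<exists>A. A \<subseteq> Field r \<and> cofinal A r \<and> cofinality r = |A| \<and>
    (\<forall>B. B \<subseteq> Field r \<and> cofinal B r \<longrightarrow> |A| \<le>o |B| )"
proof -
  let ?P = "\<lambda>A. A \<subseteq> Field r \<and> cofinal A r \<and> (\<forall>B. B \<subseteq> Field r \<and> cofinal B r \<longrightarrow> |A| \<le>o |B| )"
  let ?R = "card_of ` {A. A \<subseteq> Field r \<and> cofinal A r}"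
  have "cofinal (Field r) r"
    using infinite_Card_order_limit[of r] assms unfolding cofinal_def cinfinite_def by blast
  then have "?R \<noteq> {}" by blast
  moreover have "\<forall>s\<in>?R. Well_order s" using card_of_Well_order by blast
  ultimately have "\<exists>s\<in>?R. \<forall>s'\<in>?R. s \<le>o s'" by (rule exists_minim_Well_order)
  then have "\<exists>A. ?P A" by blast
  then have "?P (SOME A. ?P A)" by (rule someI_ex)
  then show ?thesis unfolding cofinality_def by (intro exI[of _ "SOME A. ?P A"]) simp
qed

text \<open>A sequence of length below \<mu> is too short to be cofinal in \<open>l0\<close>, hence
  bounded. So the sequences in \<open>l0\<close> split into \<open>l0\<close> many families, each
  with values in a proper initial segment, and almost closure bounds every family by
  \<open>l0\<close>.\<close>

lemma closed_below_successor:
  fixes \<mu> l0 :: "'u rel"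
  assumes \<mu>: "Cinfinite \<mu>" and l0: "almost_closed \<mu> l0"
    and cof: "\<not> cofinality l0 <o \<mu>" and A: "|A| \<le>o l0"
  shows "weak_power |A| \<mu> \<le>o l0"
proof -
  have cl0: "cardinal l0" and \<mu>l0: "\<mu> \<le>o l0" using l0 by (auto simp: almost_closed_def)
  then have inf: "Cinfinite l0" using \<mu> cinfinite_mono[OF \<mu>l0] unfolding cardinal_def by simp
  have "weak_power |A| \<mu> \<le>o weak_power l0 \<mu>"
    using card_of_mono2[OF A] by (rule weak_power_mono)
  also have "weak_power l0 \<mu> \<le>o l0"
  proof (rule weak_power_least[OF inf _ \<mu>l0])
    show "Card_order \<mu>" using \<mu> by blast
    fix a assume a: "a \<in> Field \<mu>"
    let ?X = "underS \<mu> a"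
    have X: "|?X| <o \<mu>" by (rule card_of_underS[OF conjunct2[OF \<mu>] a])
    have "?X \<rightarrow>\<^sub>E Field l0 \<subseteq> (\<Union>b\<in>Field l0. ?X \<rightarrow>\<^sub>E underS l0 b)"
    proof
      fix f assume f: "f \<in> ?X \<rightarrow>\<^sub>E Field l0"
      have K: "f ` ?X \<subseteq> Field l0" using f by auto
      have "\<not> cofinal (f ` ?X) l0"
      proof
        assume "cofinal (f ` ?X) l0"
        then have "cofinality l0 \<le>o |f ` ?X|" using cofinality_props[OF inf] K by auto
        also have "|f ` ?X| \<le>o |?X|" by (rule card_of_image)
        finally have "cofinality l0 <o \<mu>" using X by (rule ordLeq_ordLess_trans)
        then show False using cof by contradiction
      qed
      then obtain b where b: "b \<in> Field l0" "f ` ?X \<subseteq> underS l0 b"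
        using not_cofinal_bound[OF inf K] by blast
      then have "f \<in> ?X \<rightarrow>\<^sub>E underS l0 b" using f by (auto simp: PiE_iff)
      then show "f \<in> (\<Union>b\<in>Field l0. ?X \<rightarrow>\<^sub>E underS l0 b)" using b(1) by blast
    qed
    then have "|?X \<rightarrow>\<^sub>E Field l0| \<le>o |\<Union>b\<in>Field l0. ?X \<rightarrow>\<^sub>E underS l0 b|"
      by (rule card_of_mono1)
    also have "|\<Union>b\<in>Field l0. ?X \<rightarrow>\<^sub>E underS l0 b| \<le>o l0"
    proof (rule UNION_Cinfinite_bound[OF card_of_Field_eq(1)[OF conjunct2[OF inf]] _ inf], rule ballI)
      fix b assume b: "b \<in> Field l0"
      have "small (Field l0)" using cl0 by (simp add: cardinal_def)
      then have "cardinal |underS l0 b|"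
        using Order_Relation.underS_Field by (rule cardinal_card_of_subset)
      moreover have "|underS l0 b| <o l0" by (rule card_of_underS[OF conjunct2[OF inf] b])
      ultimately have "weak_power |underS l0 b| \<mu> \<le>o l0"
        using l0 unfolding almost_closed_def by blast
      moreover have "|?X \<rightarrow>\<^sub>E underS l0 b| \<le>o weak_power |underS l0 b| \<mu>"
        using PiE_le_weak_power[of \<mu> ?X "|underS l0 b|"] \<mu> X by (simp add: Field_card_of)
      ultimately show "|?X \<rightarrow>\<^sub>E underS l0 b| \<le>o l0" by (rule ordLeq_transitive[rotated])
    qed
    finally show "|?X \<rightarrow>\<^sub>E Field l0| \<le>o l0" .
  qed
  finally show ?thesis .
qed

text \<open>Used to carry regularity of a successor, which is an order on another type, over to a
  copy on \<open>'u\<close>.\<close>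

lemma regular_cardinal_cong:
  assumes "Cinfinite r" "regularCard r" "r =o s" "cardinal s"
  shows "regular_cardinal s"
  using assms Cinfinite_cong[OF assms(3,1)] regularCard_ordIso[OF assms(3,1,2)]
  by (simp add: regular_cardinal_def)

lemma cofinality_regular:
  assumes "Cinfinite r" "regularCard r"
  shows "cofinality r =o r"
proof -
  obtain A where "A \<subseteq> Field r" "cofinal A r" "cofinality r = |A|"
    using cofinality_props[OF assms(1)] by (elim exE conjE)
  then show ?thesis using assms(2) by (simp add: regularCard_def)
qed

section \<open>Structures and isomorphisms\<close>

lemma compose_tuples:
  assumes "x \<in> tuples \<tau> s U" "\<And>u. u \<in> U \<Longrightarrow> f u \<in> V"
  shows "compose (arity \<tau> s) f x \<in> tuples \<tau> s V"
  using assms by (auto simp: tuples_def compose_def)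

lemma compose_tuples_comp:
  "compose A g (compose A f x) = compose A (g \<circ> f) x"
  by (auto simp: compose_def)

lemma compose_tuples_id:
  assumes "x \<in> tuples \<tau> s U" "\<And>u. u \<in> U \<Longrightarrow> f u = u"
  shows "compose (arity \<tau> s) f x = x"
proof
  fix p
  have x: "x \<in> arity \<tau> s \<rightarrow>\<^sub>E U" using assms(1) by (simp add: tuples_def)
  show "compose (arity \<tau> s) f x p = x p"
  proof (cases "p \<in> arity \<tau> s")
    case True
    then show ?thesis using assms(2)[OF PiE_mem[OF x True]] by (simp add: compose_def)
  next
    \<comment> \<open>Off the arity both sides take the default value
      \<open>undefined\<close>.\<close>
    case False
    then show ?thesis using PiE_arb[OF x False] by (simp add: compose_def)
  qed
qed

lemma compose_tuples_cong:
  assumes "x \<in> tuples \<tau> s U" "\<And>u. u \<in> U \<Longrightarrow> f u = g u"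
  shows "compose (arity \<tau> s) f x = compose (arity \<tau> s) g x"
  using assms by (auto simp: tuples_def compose_def fun_eq_iff)

lemma tuples_mono: "U \<subseteq> V \<Longrightarrow> tuples \<tau> s U \<subseteq> tuples \<tau> s V"
  by (auto simp: tuples_def)

lemma small_mono:
  fixes A B :: "'u set"
  assumes "small B" "|A| \<le>o |B|"
  shows "small A"
  using assms ordLeq_ordLess_trans unfolding small_def by blast

lemma fint_closed:
  assumes "is_struct \<tau> M" "s \<in> Funs \<tau>" "x \<in> tuples \<tau> s (univ M)"
  shows "fint M s x \<in> univ M"
  using assms by (auto simp: is_struct_def)

text \<open>Allows an isomorphism to be cut down to its restriction, as the extensional form of
  embeddings requires.\<close>

lemma is_iso_cong:
  assumes "is_iso \<tau> f M N" "\<And>x. x \<in> univ M \<Longrightarrow> f x = g x"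
  shows "is_iso \<tau> g M N"
proof -
  have M: "is_struct \<tau> M" using assms(1) by (simp add: is_iso_def)
  have c: "compose (arity \<tau> s) f x = compose (arity \<tau> s) g x" if "x \<in> tuples \<tau> s (univ M)" for s x
    using compose_tuples_cong[OF that] assms(2) by metis
  have "g (fint M s x) = f (fint M s x)" if "s \<in> Funs \<tau>" "x \<in> tuples \<tau> s (univ M)" for s x
    using assms(2) fint_closed[OF M that] by simp
  moreover have "bij_betw g (univ M) (univ N)"
    using assms bij_betw_cong[of "univ M" f g] by (simp add: is_iso_def)
  ultimately show ?thesis
    using assms(1) by (simp add: is_iso_def c)
qed

lemma is_iso_comp:
  assumes f: "is_iso \<tau> f M N" and g: "is_iso \<tau> g N P"
  shows "is_iso \<tau> (g \<circ> f) M P"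
proof -
  have fN: "f u \<in> univ N" if "u \<in> univ M" for u
    using f that by (auto simp: is_iso_def bij_betw_def)
  have t: "compose (arity \<tau> s) f x \<in> tuples \<tau> s (univ N)" if "x \<in> tuples \<tau> s (univ M)" for s x
    using compose_tuples[OF that] fN by metis
  show ?thesis
    using f g t by (auto simp: is_iso_def compose_tuples_comp[symmetric] intro: bij_betw_trans)
qed

lemma is_iso_id: "is_struct \<tau> M \<Longrightarrow> is_iso \<tau> (\<lambda>x. x) M M"
  using compose_tuples_id[of _ \<tau> _ "univ M" "\<lambda>x. x"] by (auto simp: is_iso_def bij_betw_def)

lemma is_iso_inv:
  assumes f: "is_iso \<tau> f M N"
  shows "is_iso \<tau> (the_inv_into (univ M) f) N M"
proof -
  let ?g = "the_inv_into (univ M) f"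
  have M: "is_struct \<tau> M" and N: "is_struct \<tau> N" and bij: "bij_betw f (univ M) (univ N)"
    using f by (auto simp: is_iso_def)
  have gM: "?g u \<in> univ M" and fg: "f (?g u) = u" if "u \<in> univ N" for u
    using that bij by (auto simp: bij_betw_def the_inv_into_into f_the_inv_into_f)
  have gf: "?g (f u) = u" if "u \<in> univ M" for u
    using that bij by (auto simp: bij_betw_def the_inv_into_f_f)
  have t: "compose (arity \<tau> s) ?g x \<in> tuples \<tau> s (univ M)"
    and r: "compose (arity \<tau> s) f (compose (arity \<tau> s) ?g x) = x"
    if "x \<in> tuples \<tau> s (univ N)" for s x
    using compose_tuples[OF that] gM compose_tuples_id[OF that, of "f \<circ> ?g"] fg
    by (auto simp: compose_tuples_comp)
  have "?g (fint N s x) = fint M s (compose (arity \<tau> s) ?g x)"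
    if "s \<in> Funs \<tau>" "x \<in> tuples \<tau> s (univ N)" for s x
  proof -
    have "f (fint M s (compose (arity \<tau> s) ?g x)) = fint N s x"
      using f that t r by (simp add: is_iso_def)
    then show ?thesis
      using gf[OF fint_closed[OF M that(1) t[OF that(2)]]] by simp
  qed
  moreover have "x \<in> rint N s \<longleftrightarrow> compose (arity \<tau> s) ?g x \<in> rint M s"
    if "s \<in> Rels \<tau>" "x \<in> tuples \<tau> s (univ N)" for s x
    using f that t r by (simp add: is_iso_def)
  ultimately show ?thesis
    using M N bij_betw_the_inv_into[OF bij] by (simp add: is_iso_def)
qed

text \<open>Transport of structure along a map injective on the universe. Closure under isomorphism
  needs an isomorphic target structure to be given; this supplies one when only an injection is at
  hand.\<close>

definition image_struct ::
  "('s, 'p) vocabulary \<Rightarrow> ('u \<Rightarrow> 'u) \<Rightarrow> ('u, 's, 'p) struct \<Rightarrow> ('u, 's, 'p) struct" where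
  "image_struct \<tau> f M =
     \<lparr> univ = f ` univ M,
       fint = (\<lambda>s\<in>Funs \<tau>. \<lambda>x\<in>tuples \<tau> s (f ` univ M).
                 f (fint M s (compose (arity \<tau> s) (the_inv_into (univ M) f) x))),
       rint = (\<lambda>s. compose (arity \<tau> s) f ` rint M s) \<rparr>"

lemma is_iso_image_struct:
  assumes M: "is_struct \<tau> M" and inj: "inj_on f (univ M)"
  shows "is_iso \<tau> f M (image_struct \<tau> f M)"
proof -
  let ?g = "the_inv_into (univ M) f"
  have gf: "?g (f u) = u" if "u \<in> univ M" for u
    using that inj by (auto simp: the_inv_into_f_f)
  have gM: "?g u \<in> univ M" if "u \<in> f ` univ M" for u
    using that gf by auto
  have t: "compose (arity \<tau> s) ?g x \<in> tuples \<tau> s (univ M)" if "x \<in> tuples \<tau> s (f ` univ M)" for s x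
    using compose_tuples[OF that] gM by blast
  have tf: "compose (arity \<tau> s) f x \<in> tuples \<tau> s (f ` univ M)" if "x \<in> tuples \<tau> s (univ M)" for s x
    using compose_tuples[OF that] by blast
  have r: "compose (arity \<tau> s) ?g (compose (arity \<tau> s) f x) = x"
    if "x \<in> tuples \<tau> s (univ M)" for s x
    using compose_tuples_id[OF that, of "?g \<circ> f"] gf by (auto simp: compose_tuples_comp)
  have rel: "rint M s \<subseteq> tuples \<tau> s (univ M)" for s
    using M by (cases "s \<in> Rels \<tau>") (auto simp: is_struct_def)
  have "small (f ` univ M)"
    using M card_of_image small_mono by (metis is_struct_def)
  moreover have "f (fint M s (compose (arity \<tau> s) ?g x)) \<in> f ` univ M"
    if "s \<in> Funs \<tau>" "x \<in> tuples \<tau> s (f ` univ M)" for s x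
    using fint_closed[OF M that(1) t[OF that(2)]] by (rule imageI)
  moreover have "compose (arity \<tau> s) f ` rint M s \<subseteq> tuples \<tau> s (f ` univ M)" for s
    using tf rel by blast
  moreover have "rint M s = {}" if "s \<notin> Rels \<tau>" for s
    using M that by (simp add: is_struct_def)
  ultimately have S: "is_struct \<tau> (image_struct \<tau> f M)"
    unfolding is_struct_def image_struct_def by simp
  have "x \<in> rint M s"
    if x: "x \<in> tuples \<tau> s (univ M)" and "compose (arity \<tau> s) f x \<in> compose (arity \<tau> s) f ` rint M s" for s x
  proof -
    obtain y where y: "y \<in> rint M s" "compose (arity \<tau> s) f x = compose (arity \<tau> s) f y"
      using \<open>compose (arity \<tau> s) f x \<in> compose (arity \<tau> s) f ` rint M s\<close> by auto
    then have "y \<in> tuples \<tau> s (univ M)" using rel by blast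
    then show ?thesis using r[OF x] r[of y s] y by metis
  qed
  then have "x \<in> rint M s \<longleftrightarrow> compose (arity \<tau> s) f x \<in> rint (image_struct \<tau> f M) s"
    if "x \<in> tuples \<tau> s (univ M)" for s x
    using that by (auto simp: image_struct_def)
  moreover have "f (fint M s x) = fint (image_struct \<tau> f M) s (compose (arity \<tau> s) f x)"
    if "s \<in> Funs \<tau>" "x \<in> tuples \<tau> s (univ M)" for s x
    using that tf r by (simp add: image_struct_def)
  moreover have "bij_betw f (univ M) (univ (image_struct \<tau> f M))"
    using inj by (simp add: image_struct_def bij_betw_def)
  ultimately show ?thesis
    using M S by (simp add: is_iso_def)
qed

lemma substruct_between:
  assumes "substruct \<tau> M X" "substruct \<tau> N X" "univ M \<subseteq> univ N"
  shows "substruct \<tau> M N"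
  using assms tuples_mono[OF assms(3), of \<tau>] by (auto simp: substruct_def subset_iff)

text \<open>Actual equality is possible because structures are extensional: function symbols have
  default values off the relevant tuples, and foreign relation symbols are empty. Submodels of a
  fixed model can thus be coded by their universes.\<close>

lemma substruct_eqI:
  assumes "substruct \<tau> M X" "substruct \<tau> N X" "univ M = univ N"
  shows "M = N"
proof (rule struct.equality)
  have M: "is_struct \<tau> M" and N: "is_struct \<tau> N" using assms by (auto simp: substruct_def)
  show "fint M = fint N"
  proof (rule PiE_ext[of _ "Funs \<tau>"])
    show "fint M \<in> (\<Pi>\<^sub>E s\<in>Funs \<tau>. tuples \<tau> s (univ M) \<rightarrow>\<^sub>E univ M)" using M by (simp add: is_struct_def)
    show "fint N \<in> (\<Pi>\<^sub>E s\<in>Funs \<tau>. tuples \<tau> s (univ M) \<rightarrow>\<^sub>E univ M)"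
      using N assms(3) by (simp add: is_struct_def)
    fix s assume s: "s \<in> Funs \<tau>"
    show "fint M s = fint N s"
    proof (rule PiE_ext[of _ "tuples \<tau> s (univ M)"])
      show "fint M s \<in> tuples \<tau> s (univ M) \<rightarrow>\<^sub>E univ M" "fint N s \<in> tuples \<tau> s (univ M) \<rightarrow>\<^sub>E univ M"
        using M N assms(3) s by (auto simp: is_struct_def)
    qed (use assms s in \<open>simp add: substruct_def\<close>)
  qed
  show "rint M = rint N"
  proof
    fix s show "rint M s = rint N s"
      using assms by (cases "s \<in> Rels \<tau>") (auto simp: substruct_def is_struct_def)
  qed
qed (use assms in auto)

section \<open>Embeddings in an abstract class\<close>

lemma cat_of_simps [simp]:
  "Ob (cat_of K) = models K" "Hom (cat_of K) = K_embeddings K"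
  "Id (cat_of K) M = (\<lambda>x\<in>univ M. x)" "Comp (cat_of K) M = compose (univ M)"
  by (simp_all add: cat_of_def)

lemma set_category_simps [simp]:
  "Ob set_category = UNIV" "Hom set_category A B = (A \<rightarrow>\<^sub>E B)" "Comp set_category = compose"
  by (simp_all add: set_category_def)

locale mu_aec =
  fixes \<mu> :: "'u rel" and K :: "('u, 's, 'p) aclass"
  assumes mu_AEC: "mu_AEC \<mu> K"
begin

abbreviation Emb where "Emb \<equiv> K_embeddings K"
abbreviation \<tau> where "\<tau> \<equiv> voc K"

lemma regular: "regular_cardinal \<mu>" and abstract: "abstract_class \<mu> K"
  and coherent: "coherent K" and chain: "chain_axioms \<mu> K"
  using mu_AEC by (auto simp: mu_AEC_def)

lemma Cinfinite: "Cinfinite \<mu>"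
  using regular by (simp add: regular_cardinal_def cardinal_def)

lemma models_struct: "M \<in> models K \<Longrightarrow> is_struct \<tau> M"
  using abstract by (simp add: abstract_class_def)

lemma arity_less: "s \<in> Funs \<tau> \<union> Rels \<tau> \<Longrightarrow> |arity \<tau> s| <o \<mu>"
  using abstract by (simp add: abstract_class_def)

lemma le_partial_order: "partial_order_on (models K) (le K)"
  using abstract by (simp add: abstract_class_def)

lemma le_models: "(M, N) \<in> le K \<Longrightarrow> M \<in> models K" "(M, N) \<in> le K \<Longrightarrow> N \<in> models K"
  using partial_order_onD(4)[OF le_partial_order] by auto

lemma le_refl: "M \<in> models K \<Longrightarrow> (M, M) \<in> le K"
  using partial_order_onD(1)[OF le_partial_order] by (simp add: refl_on_def)

lemma le_trans: "(M, N) \<in> le K \<Longrightarrow> (N, P) \<in> le K \<Longrightarrow> (M, P) \<in> le K"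
  using partial_order_onD(2)[OF le_partial_order] by (meson transD)

lemma le_substruct: "(M, N) \<in> le K \<Longrightarrow> substruct \<tau> M N"
  using abstract by (simp add: abstract_class_def)

lemma le_univ: "(M, N) \<in> le K \<Longrightarrow> univ M \<subseteq> univ N"
  using le_substruct by (auto simp: substruct_def)

lemma iso_le:
  assumes "(M, N) \<in> le K" "is_iso \<tau> f N N'" "is_iso \<tau> f M M'"
  shows "(M', N') \<in> le K"
  using assms abstract unfolding abstract_class_def by blast

lemma le_between:
  assumes "(M, X) \<in> le K" "(N, X) \<in> le K" "univ M \<subseteq> univ N"
  shows "(M, N) \<in> le K"
  using coherent substruct_between[OF le_substruct[OF assms(1)] le_substruct[OF assms(2)] assms(3)]
    assms le_models unfolding coherent_def by meson

lemma EmbE: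
  assumes "f \<in> Emb M N"
  obtains M' where "is_iso \<tau> f M M'" "(M', N) \<in> le K" "univ M' = f ` univ M" "f \<in> extensional (univ M)"
  using assms by (auto simp: K_embeddings_def is_iso_def bij_betw_def)

lemma EmbI:
  assumes "is_iso \<tau> f M M'" "(M', N) \<in> le K"
  shows "restrict f (univ M) \<in> Emb M N"
proof -
  have "is_iso \<tau> (restrict f (univ M)) M M'"
    using is_iso_cong[OF assms(1)] by simp
  then show ?thesis using assms(2) by (auto simp: K_embeddings_def)
qed

lemma Emb_extensional: "f \<in> Emb M N \<Longrightarrow> f \<in> extensional (univ M)"
  by (simp add: K_embeddings_def)

lemma Emb_inj: "f \<in> Emb M N \<Longrightarrow> inj_on f (univ M)"
  by (auto simp: K_embeddings_def is_iso_def bij_betw_def)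

lemma Emb_image: "f \<in> Emb M N \<Longrightarrow> f ` univ M \<subseteq> univ N"
  by (metis EmbE le_univ)

lemma Emb_inclusion: "(M, N) \<in> le K \<Longrightarrow> (\<lambda>x\<in>univ M. x) \<in> Emb M N"
  using EmbI[OF is_iso_id] le_models models_struct by blast

lemma Emb_mono: "f \<in> Emb M N \<Longrightarrow> (N, P) \<in> le K \<Longrightarrow> f \<in> Emb M P"
  using le_trans by (auto simp: K_embeddings_def)

lemma Emb_comp:
  assumes f: "f \<in> Emb M N" and g: "g \<in> Emb N P"
  shows "compose (univ M) g f \<in> Emb M P"
proof -
  obtain M' where M': "is_iso \<tau> f M M'" "(M', N) \<in> le K" using f by (rule EmbE)
  obtain N' where N': "is_iso \<tau> g N N'" "(N', P) \<in> le K" using g by (rule EmbE)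
  have "inj_on g (univ M')"
    using Emb_inj[OF g] le_univ[OF M'(2)] by (rule inj_on_subset)
  \<comment> \<open>The isomorphism \<open>g\<close> from \<open>N\<close> onto \<open>N'\<close>
    carries \<open>M'\<close>, the image of \<open>f\<close>, to a submodel of \<open>N'\<close>,
    and thereby of \<open>P\<close>.\<close>
  then have i: "is_iso \<tau> g M' (image_struct \<tau> g M')"
    using is_iso_image_struct M' le_models models_struct by blast
  then have "(image_struct \<tau> g M', P) \<in> le K"
    using iso_le[OF M'(2) N'(1)] N'(2) le_trans by blast
  then have "restrict (g \<circ> f) (univ M) \<in> Emb M P"
    using EmbI is_iso_comp[OF M'(1) i] by blast
  then show ?thesis by (simp add: compose_def restrict_def comp_def)
qed

text \<open>The images of \<open>f\<close> and \<open>c\<close> are both submodels of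
  \<open>X\<close>, so by coherence the inclusion of the first in the second is strong. Pulling back
  along the inverse of \<open>c\<close> gives the factor.\<close>

lemma Emb_factor:
  assumes c: "c \<in> Emb D X" and f: "f \<in> Emb M X" and sub: "f ` univ M \<subseteq> c ` univ D"
  shows "\<exists>g\<in>Emb M D. compose (univ M) c g = f"
proof -
  obtain M' where M': "is_iso \<tau> f M M'" "(M', X) \<in> le K" "univ M' = f ` univ M"
    using f by (rule EmbE)
  obtain D' where D': "is_iso \<tau> c D D'" "(D', X) \<in> le K" "univ D' = c ` univ D"
    using c by (rule EmbE)
  let ?b = "the_inv_into (univ D) c"
  have b: "is_iso \<tau> ?b D' D" using D'(1) by (rule is_iso_inv)
  have M'D': "(M', D') \<in> le K" using le_between M' D' sub by metis
  then have "inj_on ?b (univ M')"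
    using b le_univ inj_on_subset by (fastforce simp: is_iso_def bij_betw_def)
  then have i: "is_iso \<tau> ?b M' (image_struct \<tau> ?b M')"
    using is_iso_image_struct M' le_models models_struct by blast
  then have "(image_struct \<tau> ?b M', D) \<in> le K"
    using iso_le[OF M'D' b] by blast
  then have g: "restrict (?b \<circ> f) (univ M) \<in> Emb M D"
    using EmbI is_iso_comp[OF M'(1) i] by blast
  have "compose (univ M) c (restrict (?b \<circ> f) (univ M)) = f"
  proof (rule extensionalityI[of _ "univ M"])
    show "compose (univ M) c (restrict (?b \<circ> f) (univ M)) \<in> extensional (univ M)"
      by simp
    show "f \<in> extensional (univ M)" using f by (rule Emb_extensional)
    fix x assume "x \<in> univ M"
    then show "compose (univ M) c (restrict (?b \<circ> f) (univ M)) x = f x"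
      using sub f_the_inv_into_f[OF Emb_inj[OF c]] by (auto simp: compose_def)
  qed
  then show ?thesis using g by blast
qed

end

section \<open>Directed colimits\<close>

lemma directed_poset_mono:
  assumes "directed_poset l' I r" "l \<le>o l'"
  shows "directed_poset l I r"
  using assms ordLess_ordLeq_trans unfolding directed_poset_def by blast

lemma presentable_mono:
  fixes l l' :: "'u rel"
  assumes "presentable C l M" "l \<le>o l'"
  shows "presentable C l' M"
  using assms directed_poset_mono unfolding presentable_def by blast

lemma colimitD:
  assumes "colimit C I r D d X c"
  shows "cocone C I r D d X c"
    and "cocone C I r D d Y e \<Longrightarrow>
      \<exists>h. h \<in> Hom C X Y \<and> (\<forall>i\<in>I. Comp C (D i) h (c i) = e i)"
    and "cocone C I r D d Y e \<Longrightarrow> h \<in> Hom C X Y \<Longrightarrow> (\<And>i. i \<in> I \<Longrightarrow> Comp C (D i) h (c i) = e i) \<Longrightarrow>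
      h' \<in> Hom C X Y \<Longrightarrow> (\<And>i. i \<in> I \<Longrightarrow> Comp C (D i) h' (c i) = e i) \<Longrightarrow> h = h'"
  using assms unfolding colimit_def by blast+

text \<open>If no leg reached \<open>x\<close>, the constant map \<open>a\<close> and the map
  altered to \<open>b\<close> at \<open>x\<close> alone would agree on every leg, against
  uniqueness. The test object is a set in the element type of \<open>X\<close>, which must therefore
  have two distinct elements.\<close>

lemma colimit_set_category_covers:
  fixes X :: "'x set" and a b :: 'x
  assumes col: "colimit set_category I r S s X c" and x: "x \<in> X" and ab: "a \<noteq> b"
    and s: "\<And>i j. i \<in> I \<Longrightarrow> j \<in> I \<Longrightarrow> (i, j) \<in> r \<Longrightarrow> s i j \<in> S i \<rightarrow> S j"
  shows "\<exists>i\<in>I. x \<in> c i ` S i"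
proof (rule ccontr)
  assume no: "\<not> (\<exists>i\<in>I. x \<in> c i ` S i)"
  define e :: "_ \<Rightarrow> 'x \<Rightarrow> 'x" where "e = (\<lambda>i. \<lambda>y\<in>S i. a)"
  have cX: "c i \<in> S i \<rightarrow>\<^sub>E X" if "i \<in> I" for i
    using colimitD(1)[OF col] that by (simp add: cocone_def)
  have e: "cocone set_category I r S s {a, b} e"
    unfolding cocone_def
  proof (intro conjI ballI impI)
    fix i j assume "i \<in> I" "j \<in> I" "(i, j) \<in> r"
    from s[OF this] show "Comp set_category (S i) (e j) (s i j) = e i"
      by (auto simp: e_def compose_def fun_eq_iff)
  qed (auto simp: e_def)
  have eq: "(\<lambda>y\<in>X. a) = (\<lambda>y\<in>X. if y = x then b else a)"
  proof (rule colimitD(3)[OF col e], goal_cases)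
    case (2 i)
    then show ?case using cX[OF 2] by (auto simp: e_def compose_def fun_eq_iff)
  next
    case (4 i)
    have "c i y \<noteq> x" if "y \<in> S i" for y using no 4 that by blast
    then show ?case using cX[OF 4] by (auto simp: e_def compose_def fun_eq_iff)
  qed auto
  show False using fun_cong[OF eq, of x] x ab by simp
qed

section \<open>Colimits as unions of images, and presentability above the size of the model\<close>

context mu_aec
begin

lemma cocone_image_mono:
  assumes D: "diagram (cat_of K) I r D d" and c: "cocone (cat_of K) I r D d X c"
    and ij: "i \<in> I" "j \<in> I" "(i, j) \<in> r"
  shows "c i ` univ (D i) \<subseteq> c j ` univ (D j)"
proof (rule image_subsetI)
  fix x assume x: "x \<in> univ (D i)"
  have "d i j \<in> Emb (D i) (D j)" using D ij by (simp add: diagram_def)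
  then have "d i j x \<in> univ (D j)" using Emb_image x by blast
  moreover have "compose (univ (D i)) (c j) (d i j) = c i" using c ij by (simp add: cocone_def)
  then have "c i x = c j (d i j x)" using compose_eq[OF x] by metis
  ultimately show "c i x \<in> c j ` univ (D j)" by simp
qed

text \<open>The images of the legs are submodels of \<open>X\<close> and, by coherence, form a
  \<mu>-directed system; the chain axioms put their union below \<open>X\<close>.\<close>

lemma cocone_union:
  fixes I :: "'u set"
  assumes I: "small I" and r: "directed_poset \<mu> I r" and D: "diagram (cat_of K) I r D d"
    and c: "cocone (cat_of K) I r D d X c"
  shows "\<exists>U. (U, X) \<in> le K \<and> univ U = (\<Union>i\<in>I. c i ` univ (D i)) \<and> (\<forall>i\<in>I. c i \<in> Emb (D i) U)"
proof -
  have X: "X \<in> models K" and cE: "\<And>i. i \<in> I \<Longrightarrow> c i \<in> Emb (D i) X"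
    and cc: "\<And>i j. i \<in> I \<Longrightarrow> j \<in> I \<Longrightarrow> (i, j) \<in> r \<Longrightarrow> compose (univ (D i)) (c j) (d i j) = c i"
    using c by (auto simp: cocone_def)
  have "\<exists>E. is_iso \<tau> (c i) (D i) E \<and> (E, X) \<in> le K \<and> univ E = c i ` univ (D i)" if "i \<in> I" for i
    using cE[OF that] by (metis EmbE)
  then obtain E where E: "\<And>i. i \<in> I \<Longrightarrow> is_iso \<tau> (c i) (D i) (E i)"
      "\<And>i. i \<in> I \<Longrightarrow> (E i, X) \<in> le K" "\<And>i. i \<in> I \<Longrightarrow> univ (E i) = c i ` univ (D i)"
    by metis
  have mono: "(E i, E j) \<in> le K" if "i \<in> I" "j \<in> I" "(i, j) \<in> r" for i j
    using le_between[OF E(2) E(2)] E(3) cocone_image_mono[OF D c that] that by simp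
  let ?U = "union_struct \<tau> I E"
  \<comment> \<open>The chain axioms ask for a small union, which holds inside the small universe of
    \<open>X\<close>.\<close>
  have "(\<Union>i\<in>I. univ (E i)) \<subseteq> univ X" using E(2) le_univ by blast
  then have "small (\<Union>i\<in>I. univ (E i))"
    using models_struct[OF X] small_mono card_of_mono1 unfolding is_struct_def by blast
  then have "(?U, X) \<in> le K" "\<And>i. i \<in> I \<Longrightarrow> (E i, ?U) \<in> le K"
    using chain I r mono E(2) X le_models unfolding chain_axioms_def by metis+
  moreover have "univ ?U = (\<Union>i\<in>I. c i ` univ (D i))"
    using E(3) by (simp add: union_struct_def)
  moreover have "c i \<in> Emb (D i) ?U" if "i \<in> I" for i
    using E(1)[OF that] calculation(2)[OF that] Emb_extensional[OF cE[OF that]]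
    by (auto simp: K_embeddings_def)
  ultimately show ?thesis by blast
qed

text \<open>The union \<open>U\<close> of the images carries a cocone too. The induced map from
  \<open>X\<close> to \<open>U\<close>, read as a map into \<open>X\<close>, fixes the legs and so
  is the identity; hence \<open>U\<close> exhausts \<open>X\<close>.\<close>

lemma colimit_univ:
  fixes I :: "'u set"
  assumes I: "small I" and r: "directed_poset \<mu> I r" and D: "diagram (cat_of K) I r D d"
    and c: "colimit (cat_of K) I r D d X c"
  shows "univ X = (\<Union>i\<in>I. c i ` univ (D i))"
proof -
  have cc: "cocone (cat_of K) I r D d X c" using c by (simp add: colimit_def)
  then have X: "X \<in> models K" by (simp add: cocone_def)
  obtain U where "(U, X) \<in> le K \<and> univ U = (\<Union>i\<in>I. c i ` univ (D i)) \<and> (\<forall>i\<in>I. c i \<in> Emb (D i) U)"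
    using cocone_union[OF I r D cc] ..
  then have U: "(U, X) \<in> le K" "univ U = (\<Union>i\<in>I. c i ` univ (D i))" "\<forall>i\<in>I. c i \<in> Emb (D i) U"
    by simp_all
  have Uc: "cocone (cat_of K) I r D d U c"
    using cc U(3) le_models(1)[OF U(1)] by (simp add: cocone_def)
  obtain h where "h \<in> Hom (cat_of K) X U \<and> (\<forall>i\<in>I. Comp (cat_of K) (D i) h (c i) = c i)"
    using colimitD(2)[OF c Uc] ..
  then have h: "h \<in> Emb X U" "\<forall>i\<in>I. compose (univ (D i)) h (c i) = c i" by simp_all
  have "h = (\<lambda>x\<in>univ X. x)"
  proof (rule colimitD(3)[OF c cc], goal_cases)
    case 1
    show ?case using Emb_mono[OF h(1) U(1)] by simp
  next
    case (2 i)
    then show ?case using h(2) by simp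
  next
    case 3
    show ?case using Emb_inclusion[OF le_refl[OF X]] by simp
  next
    case (4 i)
    then have ci: "c i \<in> Emb (D i) X" using cc by (simp add: cocone_def)
    show ?case
      using Emb_image[OF ci] Emb_extensional[OF ci]
      by (intro extensionalityI[of _ "univ (D i)"]) (auto simp: compose_def)
  qed
  then have "univ X \<subseteq> univ U" using Emb_image[OF h(1)] by auto
  then show ?thesis using U(2) le_univ[OF U(1)] by simp
qed

lemma directed_bound:
  assumes r: "directed_poset l I r" and A: "|A| <o l" and U: "f ` A \<subseteq> (\<Union>i\<in>I. V i)"
    and mono: "\<And>i j. i \<in> I \<Longrightarrow> j \<in> I \<Longrightarrow> (i, j) \<in> r \<Longrightarrow> V i \<subseteq> V j"
  shows "\<exists>i\<in>I. f ` A \<subseteq> V i"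
proof -
  have "\<exists>i\<in>I. f a \<in> V i" if "a \<in> A" for a using U that by blast
  then obtain s where s: "\<And>a. a \<in> A \<Longrightarrow> s a \<in> I" "\<And>a. a \<in> A \<Longrightarrow> f a \<in> V (s a)" by metis
  have "|s ` A| <o l" using card_of_image A by (rule ordLeq_ordLess_trans)
  then obtain b where b: "b \<in> I" "\<And>a. a \<in> A \<Longrightarrow> (s a, b) \<in> r"
    using r s(1) unfolding directed_poset_def by (metis imageI image_subsetI)
  then have "f ` A \<subseteq> V b" using s mono by blast
  then show ?thesis using b by blast
qed

lemma compose_inj_left:
  assumes "c \<in> Emb D X" "g \<in> Emb M D" "g' \<in> Emb M D"
    and eq: "compose (univ M) c g = compose (univ M) c g'"
  shows "g = g'"
proof (rule extensionalityI)
  show "g \<in> extensional (univ M)" "g' \<in> extensional (univ M)"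
    using assms Emb_extensional by auto
  fix x assume x: "x \<in> univ M"
  then have "c (g x) = c (g' x)" using eq by (metis compose_eq)
  then show "g x = g' x"
    using Emb_inj[OF assms(1)] Emb_image[OF assms(2)] Emb_image[OF assms(3)] x
    by (auto dest: inj_onD)
qed

lemma compose_assoc_Emb:
  assumes "f \<in> Emb M N"
  shows "compose (univ M) h (compose (univ M) g f) = compose (univ M) (compose (univ N) h g) f"
  using Emb_image[OF assms] by (auto simp: compose_def fun_eq_iff)

lemma hom_map_apply:
  "g \<in> Emb M X \<Longrightarrow> hom_map (cat_of K) M X f g = compose (univ M) f g"
  by (simp add: hom_map_def)

text \<open>The image of a map from \<open>M\<close> into the colimit has fewer than
  \<open>l\<close> points and is caught by one stage, so the map factors through it. Two
  factorisations become equal at a later stage because the legs are injective.\<close>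

lemma presentable_large:
  fixes l :: "'u rel"
  assumes M: "M \<in> models K" and Mr: "|univ M| <o l" and l: "\<mu> \<le>o l" and linf: "Cinfinite l"
  shows "presentable (cat_of K) l M"
  unfolding presentable_def
proof (intro conjI allI impI; (elim conjE)?)
  show "M \<in> Ob (cat_of K)" using M by simp
next
  fix I :: "'u set" and r D d X c
  assume I: "small I" and r: "directed_poset l I r" and D: "diagram (cat_of K) I r D d"
    and c: "colimit (cat_of K) I r D d X c"
  let ?h = "\<lambda>i. hom_map (cat_of K) M (D i) (c i)"
  let ?hd = "\<lambda>i j. hom_map (cat_of K) M (D i) (d i j)"
  have r\<mu>: "directed_poset \<mu> I r" using r l by (rule directed_poset_mono)
  have cc: "cocone (cat_of K) I r D d X c" using c by (simp add: colimit_def)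
  have cE: "c i \<in> Emb (D i) X" if "i \<in> I" for i
    using cc that by (simp add: cocone_def)
  have dE: "d i j \<in> Emb (D i) (D j)" if "i \<in> I" "j \<in> I" "(i, j) \<in> r" for i j
    using D that by (simp add: diagram_def)
  have cd: "compose (univ (D i)) (c j) (d i j) = c i" if "i \<in> I" "j \<in> I" "(i, j) \<in> r" for i j
    using cc that by (simp add: cocone_def)
  have X: "univ X = (\<Union>i\<in>I. c i ` univ (D i))"
    using I r\<mu> D c by (rule colimit_univ)
  have factor: "\<exists>i\<in>I. \<exists>g\<in>Emb M (D i). compose (univ M) (c i) g = f" if f: "f \<in> Emb M X" for f
  proof -
    have "f ` univ M \<subseteq> (\<Union>i\<in>I. c i ` univ (D i))" using Emb_image[OF f] X by simp
    then have "\<exists>i\<in>I. f ` univ M \<subseteq> c i ` univ (D i)"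
      using cocone_image_mono[OF D cc] by (intro directed_bound[OF r Mr]) simp_all
    then obtain i where i: "i \<in> I" "f ` univ M \<subseteq> c i ` univ (D i)" ..
    show ?thesis using i(1) Emb_factor[OF cE[OF i(1)] f i(2)] by (rule bexI[rotated])
  qed
  have comp: "compose (univ M) (c j) (compose (univ M) (d i j) g) = compose (univ M) (c i) g"
    if "i \<in> I" "j \<in> I" "(i, j) \<in> r" "g \<in> Emb M (D i)" for i j g
    using compose_assoc_Emb[OF that(4), of "c j" "d i j"] cd[OF that(1-3)] by simp
  show "colimit set_category I r (\<lambda>i. Hom (cat_of K) M (D i)) ?hd (Hom (cat_of K) M X) ?h"
    unfolding colimit_def
  proof (intro conjI allI impI)
    have "?h i \<in> Emb M (D i) \<rightarrow>\<^sub>E Emb M X" if "i \<in> I" for i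
      using Emb_comp[OF _ cE[OF that]] by (simp add: hom_map_def)
    moreover have "compose (Emb M (D i)) (?h j) (?hd i j) = ?h i" if ij: "i \<in> I" "j \<in> I" "(i, j) \<in> r" for i j
    proof (rule extensionalityI)
      fix g assume g: "g \<in> Emb M (D i)"
      then show "compose (Emb M (D i)) (?h j) (?hd i j) g = ?h i g"
        using comp[OF ij g] Emb_comp[OF g dE[OF ij]] by (simp add: compose_def hom_map_apply)
    qed (auto simp: hom_map_def)
    ultimately show "cocone set_category I r (\<lambda>i. Hom (cat_of K) M (D i)) ?hd (Hom (cat_of K) M X) ?h"
      by (simp add: cocone_def)
  next
    fix Y e
    assume Y: "cocone set_category I r (\<lambda>i. Hom (cat_of K) M (D i)) ?hd Y e"
    have e: "e i \<in> Emb M (D i) \<rightarrow>\<^sub>E Y" if "i \<in> I" for i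
      using Y that by (simp add: cocone_def)
    have ee: "compose (Emb M (D i)) (e j) (?hd i j) = e i" if "i \<in> I" "j \<in> I" "(i, j) \<in> r" for i j
      using Y that by (simp add: cocone_def)
    have e_d: "e j (compose (univ M) (d i j) g) = e i g"
      if "i \<in> I" "j \<in> I" "(i, j) \<in> r" "g \<in> Emb M (D i)" for i j g
      using fun_cong[OF ee[OF that(1-3)], of g] that(4) by (simp add: compose_def hom_map_apply)
    \<comment> \<open>Independence of the factorisation: both maps are pushed to a common stage
      \<open>k\<close>, where the injective leg \<open>c k\<close> identifies them.\<close>
    have wd: "e i g = e j g'"
      if i: "i \<in> I" and j: "j \<in> I" and g: "g \<in> Emb M (D i)" and g': "g' \<in> Emb M (D j)"
        and eq: "compose (univ M) (c i) g = compose (univ M) (c j) g'" for i j g g'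
    proof -
      have "|{i, j}| <o l"
        using linf by (intro finite_ordLess_Cinfinite) simp_all
      then obtain k where k: "k \<in> I" "(i, k) \<in> r" "(j, k) \<in> r"
        using r i j unfolding directed_poset_def by (metis empty_subsetI insertCI insert_subset)
      have "compose (univ M) (d i k) g = compose (univ M) (d j k) g'"
        using comp[OF i k(1,2) g] comp[OF j k(1,3) g'] eq
          compose_inj_left[OF cE[OF k(1)] Emb_comp[OF g dE[OF i k(1,2)]] Emb_comp[OF g' dE[OF j k(1,3)]]]
        by simp
      then show ?thesis using e_d[OF i k(1,2) g] e_d[OF j k(1,3) g'] by simp
    qed
    \<comment> \<open>The mediating map sends \<open>f\<close> to the value of \<open>e\<close> at
      any factorisation of \<open>f\<close>.\<close>
    let ?Q = "\<lambda>f y. \<exists>i\<in>I. \<exists>g\<in>Emb M (D i). compose (univ M) (c i) g = f \<and> y = e i g"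
    have Q: "?Q f (SOME y. ?Q f y)" if "f \<in> Emb M X" for f
      using factor[OF that] by (intro someI_ex[of "?Q f"]) blast
    define h where "h = (\<lambda>f\<in>Emb M X. SOME y. ?Q f y)"
    have h: "h (compose (univ M) (c i) g) = e i g" if "i \<in> I" "g \<in> Emb M (D i)" for i g
    proof -
      have f: "compose (univ M) (c i) g \<in> Emb M X" using Emb_comp[OF that(2) cE[OF that(1)]] .
      obtain j g' where "j \<in> I" "g' \<in> Emb M (D j)" "compose (univ M) (c j) g' = compose (univ M) (c i) g"
        "h (compose (univ M) (c i) g) = e j g'"
        using Q[OF f] f unfolding h_def by auto
      then show ?thesis using wd[OF _ that(1) _ that(2)] by simp
    qed
    show "\<exists>!h. h \<in> Hom set_category (Hom (cat_of K) M X) Y \<and>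
        (\<forall>i\<in>I. Comp set_category (Hom (cat_of K) M (D i)) h (?h i) = e i)"
    proof (rule ex1I[of _ h], intro conjI ballI)
      have "h f \<in> Y" if f: "f \<in> Emb M X" for f
      proof -
        obtain i g where "i \<in> I" "g \<in> Emb M (D i)" "compose (univ M) (c i) g = f"
          using factor[OF f] by blast
        then show ?thesis using h PiE_mem[OF e] by metis
      qed
      then show "h \<in> Hom set_category (Hom (cat_of K) M X) Y"
        by (auto simp: h_def)
    next
      fix i assume i: "i \<in> I"
      have "compose (Emb M (D i)) h (?h i) = e i"
      proof (rule extensionalityI)
        show "e i \<in> extensional (Emb M (D i))" using e[OF i] by (simp add: PiE_def)
        fix g assume "g \<in> Emb M (D i)"
        then show "compose (Emb M (D i)) h (?h i) g = e i g"
          using h[OF i] by (simp add: compose_def hom_map_apply)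
      qed simp
      then show "Comp set_category (Hom (cat_of K) M (D i)) h (?h i) = e i" by simp
    next
      fix h' assume h': "h' \<in> Hom set_category (Hom (cat_of K) M X) Y \<and>
        (\<forall>i\<in>I. Comp set_category (Hom (cat_of K) M (D i)) h' (?h i) = e i)"
      show "h' = h"
      proof (rule extensionalityI)
        show "h' \<in> extensional (Emb M X)" using h' by (simp add: PiE_def)
        show "h \<in> extensional (Emb M X)" by (simp add: h_def)
        fix f assume "f \<in> Emb M X"
        then obtain i g where ig: "i \<in> I" "g \<in> Emb M (D i)" "compose (univ M) (c i) g = f"
          using factor by blast
        have "compose (Emb M (D i)) h' (?h i) g = e i g" using h' ig by simp
        then have "h' f = e i g" using ig by (simp add: compose_def hom_map_apply)
        then show "h' f = h f" using h[OF ig(1,2)] ig(3) by simp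
      qed
    qed
  qed
qed

section \<open>Models as colimits of their submodels, and failure of presentability\<close>

lemma Emb_fint:
  assumes f: "f \<in> Emb M N" and s: "s \<in> Funs \<tau>" and x: "x \<in> tuples \<tau> s (univ M)"
  shows "f (fint M s x) = fint N s (compose (arity \<tau> s) f x)"
proof -
  obtain M' where M': "is_iso \<tau> f M M'" "(M', N) \<in> le K" "univ M' = f ` univ M"
    using f by (rule EmbE)
  have "compose (arity \<tau> s) f x \<in> tuples \<tau> s (univ M')"
    using compose_tuples[OF x, of f "univ M'"] M'(3) by simp
  then show ?thesis
    using M'(1) le_substruct[OF M'(2)] s x by (simp add: is_iso_def substruct_def)
qed

lemma Emb_rint:
  assumes f: "f \<in> Emb M N" and s: "s \<in> Rels \<tau>" and x: "x \<in> tuples \<tau> s (univ M)"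
  shows "x \<in> rint M s \<longleftrightarrow> compose (arity \<tau> s) f x \<in> rint N s"
proof -
  obtain M' where M': "is_iso \<tau> f M M'" "(M', N) \<in> le K" "univ M' = f ` univ M"
    using f by (rule EmbE)
  have "compose (arity \<tau> s) f x \<in> tuples \<tau> s (univ M')"
    using compose_tuples[OF x, of f "univ M'"] M'(3) by simp
  then show ?thesis
    using M'(1) le_substruct[OF M'(2)] s x by (simp add: is_iso_def substruct_def)
qed

text \<open>Injectivity and the preservation of each function value or relation concern fewer than
  \<mu> points at a time, as arities are below \<mu>. Such points lie in a single
  \<open>D i\<close>, where \<open>h\<close> agrees with the embedding \<open>e i\<close>.\<close>

lemma is_iso_union:
  assumes M: "M \<in> models K" and U: "U \<in> models K"
    and r: "directed_poset \<mu> I r"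
    and D: "\<And>i. i \<in> I \<Longrightarrow> (D i, M) \<in> le K"
    and mono: "\<And>i j. i \<in> I \<Longrightarrow> j \<in> I \<Longrightarrow> (i, j) \<in> r \<Longrightarrow> univ (D i) \<subseteq> univ (D j)"
    and uM: "univ M = (\<Union>i\<in>I. univ (D i))"
    and e: "\<And>i. i \<in> I \<Longrightarrow> e i \<in> Emb (D i) U"
    and uU: "univ U = (\<Union>i\<in>I. e i ` univ (D i))"
    and h: "\<And>i x. i \<in> I \<Longrightarrow> x \<in> univ (D i) \<Longrightarrow> h x = e i x"
  shows "is_iso \<tau> h M U"
proof -
  have catch: "\<exists>i\<in>I. f ` A \<subseteq> univ (D i)" if "|A| <o \<mu>" "f ` A \<subseteq> univ M" for A :: "'z set" and f
    using that uM by (intro directed_bound[OF r _ _ mono]) simp_all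
  have "inj_on h (univ M)"
  proof (rule inj_onI)
    fix x y assume xy: "x \<in> univ M" "y \<in> univ M" "h x = h y"
    have "|{x, y}| <o \<mu>"
      using Cinfinite by (intro finite_ordLess_Cinfinite) simp_all
    then have "\<exists>i\<in>I. (\<lambda>x. x) ` {x, y} \<subseteq> univ (D i)" using xy by (intro catch) auto
    then obtain i where i: "i \<in> I" "x \<in> univ (D i)" "y \<in> univ (D i)" by auto
    then show "x = y" using Emb_inj[OF e[OF i(1)]] h[OF i(1)] xy(3) by (auto dest: inj_onD)
  qed
  moreover have "h ` univ M = univ U"
    unfolding uM uU image_UN using h by (intro SUP_cong image_cong) simp_all
  ultimately have "bij_betw h (univ M) (univ U)" by (simp add: bij_betw_def)
  moreover have "h (fint M s x) = fint U s (compose (arity \<tau> s) h x)"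
      if s: "s \<in> Funs \<tau>" and x: "x \<in> tuples \<tau> s (univ M)" for s x
  proof -
    have "\<exists>i\<in>I. x ` arity \<tau> s \<subseteq> univ (D i)"
      using x arity_less s by (intro catch) (auto simp: tuples_def)
    then obtain i where i: "i \<in> I" and xi: "x \<in> tuples \<tau> s (univ (D i))"
      using x by (auto simp: tuples_def PiE_iff)
    have Di: "is_struct \<tau> (D i)" using models_struct le_models D i by blast
    have "fint M s x = fint (D i) s x"
      using le_substruct[OF D[OF i]] s xi by (simp add: substruct_def)
    then have "h (fint M s x) = e i (fint (D i) s x)"
      using h[OF i fint_closed[OF Di s xi]] by simp
    also have "\<dots> = fint U s (compose (arity \<tau> s) (e i) x)"
      using Emb_fint[OF e[OF i] s xi] .
    also have "compose (arity \<tau> s) (e i) x = compose (arity \<tau> s) h x"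
      using compose_tuples_cong[OF xi, of "e i" h] h[OF i] by simp
    finally show ?thesis .
  qed
  moreover have "x \<in> rint M s \<longleftrightarrow> compose (arity \<tau> s) h x \<in> rint U s"
      if s: "s \<in> Rels \<tau>" and x: "x \<in> tuples \<tau> s (univ M)" for s x
  proof -
    have "\<exists>i\<in>I. x ` arity \<tau> s \<subseteq> univ (D i)"
      using x arity_less s by (intro catch) (auto simp: tuples_def)
    then obtain i where i: "i \<in> I" and xi: "x \<in> tuples \<tau> s (univ (D i))"
      using x by (auto simp: tuples_def PiE_iff)
    have "x \<in> rint M s \<longleftrightarrow> x \<in> rint (D i) s"
      using le_substruct[OF D[OF i]] s xi by (simp add: substruct_def)
    also have "\<dots> \<longleftrightarrow> compose (arity \<tau> s) (e i) x \<in> rint U s"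
      using Emb_rint[OF e[OF i] s xi] .
    also have "compose (arity \<tau> s) (e i) x = compose (arity \<tau> s) h x"
      using compose_tuples_cong[OF xi, of "e i" h] h[OF i] by simp
    finally show ?thesis .
  qed
  ultimately show ?thesis using models_struct M U by (simp add: is_iso_def)
qed

text \<open>The legs of a cocone glue to a map \<open>h\<close> on \<open>M\<close>. It is an
  isomorphism onto the union of their images, which is a submodel of \<open>Y\<close>, so
  \<open>h\<close> is an embedding and not merely a function.\<close>

lemma colimit_submodels:
  fixes I :: "'u set"
  assumes M: "M \<in> models K" and I: "small I" and r: "directed_poset \<mu> I r"
    and D: "\<And>i. i \<in> I \<Longrightarrow> (D i, M) \<in> le K"
    and mono: "\<And>i j. i \<in> I \<Longrightarrow> j \<in> I \<Longrightarrow> (i, j) \<in> r \<Longrightarrow> univ (D i) \<subseteq> univ (D j)"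
    and uM: "univ M = (\<Union>i\<in>I. univ (D i))"
  shows "diagram (cat_of K) I r D (\<lambda>i j. \<lambda>x\<in>univ (D i). x)"
    and "colimit (cat_of K) I r D (\<lambda>i j. \<lambda>x\<in>univ (D i). x) M (\<lambda>i. \<lambda>x\<in>univ (D i). x)"
proof -
  let ?d = "\<lambda>i j. \<lambda>x\<in>univ (D i). x" and ?c = "\<lambda>i. \<lambda>x\<in>univ (D i). x"
  have dE: "(\<lambda>x\<in>univ (D i). x) \<in> Emb (D i) (D j)" if "i \<in> I" "j \<in> I" "(i, j) \<in> r" for i j
    using Emb_inclusion[OF le_between[OF D D mono]] that by simp
  have cm: "compose (univ (D i)) g (\<lambda>x\<in>univ (D i). x) = restrict g (univ (D i))" for g i
    by (auto simp: compose_def fun_eq_iff)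
  have rr: "univ (D j) \<inter> univ (D i) = univ (D i)" if "i \<in> I" "j \<in> I" "(i, j) \<in> r" for i j
    using mono[OF that] by blast
  have rM: "univ M \<inter> univ (D i) = univ (D i)" if "i \<in> I" for i
    using D[OF that] le_univ by blast
  show dia: "diagram (cat_of K) I r D ?d"
    unfolding diagram_def using dE le_models(1)[OF D] by (simp add: cm rr)
  have coc: "cocone (cat_of K) I r D ?d M ?c"
    unfolding cocone_def using M Emb_inclusion[OF D] by (simp add: cm rr rM)
  show "colimit (cat_of K) I r D ?d M ?c"
    unfolding colimit_def
  proof (intro conjI allI impI coc)
    fix Y e assume Y: "cocone (cat_of K) I r D ?d Y e"
    have ee: "restrict (e j) (univ (D i)) = e i" if "i \<in> I" "j \<in> I" "(i, j) \<in> r" for i j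
      using Y that by (simp add: cocone_def cm)
    have eY: "e i \<in> Emb (D i) Y" if "i \<in> I" for i using Y that by (simp add: cocone_def)
    have emono: "e i x = e j x" if "i \<in> I" "j \<in> I" "(i, j) \<in> r" "x \<in> univ (D i)" for i j x
      using fun_cong[OF ee[OF that(1-3)], of x] that(4) by simp
    \<comment> \<open>Two indices are compared through a common upper bound, making the choice in
      \<open>h\<close> below harmless.\<close>
    have agree: "e i x = e j x" if i: "i \<in> I" and j: "j \<in> I" and x: "x \<in> univ (D i)" "x \<in> univ (D j)" for i j x
    proof -
      have "|{i, j}| <o \<mu>"
        using Cinfinite by (intro finite_ordLess_Cinfinite) simp_all
      then obtain k where k: "k \<in> I" "(i, k) \<in> r" "(j, k) \<in> r"
        using r i j unfolding directed_poset_def by (metis empty_subsetI insertCI insert_subset)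
      then show ?thesis using emono[OF i k(1,2) x(1)] emono[OF j k(1,3) x(2)] by simp
    qed
    obtain U where "(U, Y) \<in> le K \<and> univ U = (\<Union>i\<in>I. e i ` univ (D i)) \<and> (\<forall>i\<in>I. e i \<in> Emb (D i) U)"
      using cocone_union[OF I r dia Y] ..
    then have U: "(U, Y) \<in> le K" "univ U = (\<Union>i\<in>I. e i ` univ (D i))" "\<And>i. i \<in> I \<Longrightarrow> e i \<in> Emb (D i) U"
      by simp_all
    define h where "h = (\<lambda>x. e (SOME i. i \<in> I \<and> x \<in> univ (D i)) x)"
    have h: "h x = e i x" if "i \<in> I" "x \<in> univ (D i)" for i x
    proof -
      have "(SOME i. i \<in> I \<and> x \<in> univ (D i)) \<in> I \<and> x \<in> univ (D (SOME i. i \<in> I \<and> x \<in> univ (D i)))"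
        using that by (intro someI_ex[of "\<lambda>i. i \<in> I \<and> x \<in> univ (D i)"]) blast
      then show ?thesis unfolding h_def using agree[OF _ that(1) _ that(2)] by simp
    qed
    have "is_iso \<tau> h M U"
      using M le_models(1)[OF U(1)] r D mono uM U(3) U(2) h
      by (rule is_iso_union[where D = D and e = e and h = h])
    then have hE: "restrict h (univ M) \<in> Emb M Y" using U(1) by (rule EmbI)
    have sub: "univ (D i) \<subseteq> univ M" if "i \<in> I" for i using D[OF that] by (rule le_univ)
    show "\<exists>!h. h \<in> Hom (cat_of K) M Y \<and> (\<forall>i\<in>I. Comp (cat_of K) (D i) h (?c i) = e i)"
    proof (rule ex1I[of _ "restrict h (univ M)"], intro conjI ballI)
      show "restrict h (univ M) \<in> Hom (cat_of K) M Y" using hE by simp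
      fix i assume i: "i \<in> I"
      have "restrict (restrict h (univ M)) (univ (D i)) = e i"
        using sub[OF i] h[OF i] Emb_extensional[OF eY[OF i]]
        by (intro extensionalityI[of _ "univ (D i)"]) auto
      then show "Comp (cat_of K) (D i) (restrict h (univ M)) (?c i) = e i" by (simp add: cm)
    next
      fix h' assume h': "h' \<in> Hom (cat_of K) M Y \<and> (\<forall>i\<in>I. Comp (cat_of K) (D i) h' (?c i) = e i)"
      then have h'e: "restrict h' (univ (D i)) = e i" if "i \<in> I" for i using that by (simp add: cm)
      show "h' = restrict h (univ M)"
      proof (rule extensionalityI)
        show "h' \<in> extensional (univ M)" using h' Emb_extensional[of h' M Y] by simp
        fix x assume x: "x \<in> univ M"
        then obtain i where i: "i \<in> I" "x \<in> univ (D i)" using uM by auto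
        then show "h' x = restrict h (univ M) x" using fun_cong[OF h'e[OF i(1)], of x] h[OF i] i(2) x by simp
      qed simp
    qed
  qed
qed

text \<open>\<open>closed\<close> and the Loewenheim-Skolem-Tarski axiom put every subset of
  \<open>M\<close> smaller than \<open>l\<close> inside a submodel smaller than \<open>l\<close>;
  regularity of \<open>l\<close> then makes these submodels \<open>l\<close>-directed.\<close>

lemma not_presentable:
  fixes l L :: "'u rel"
  assumes M: "M \<in> models K" and Pow: "|Pow (univ M)| <o |UNIV :: 'u set|"
    and L: "LST_cardinal \<mu> K L" "L <o l"
    and l: "regular_cardinal l" "\<mu> \<le>o l" "l \<le>o |univ M|"
    and closed: "\<And>A. A \<subseteq> univ M \<Longrightarrow> |A| <o l \<Longrightarrow> weak_power |A| \<mu> <o l"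
  shows "\<not> presentable (cat_of K) l M"
proof
  assume pres: "presentable (cat_of K) l M"
  have linf: "Cinfinite l" and lreg: "regularCard l"
    using l(1) by (auto simp: regular_cardinal_def cardinal_def)
  define F where "F = {N. (N, M) \<in> le K \<and> |univ N| <o l}"
  \<comment> \<open>Indices must be elements of \<open>'u\<close>. The size assumption provides an
    injection of the power set of the universe into \<open>'u\<close>, and a submodel is coded by
    its universe; the same assumption makes the index set small.\<close>
  have "\<exists>g :: 'u set \<Rightarrow> 'u. inj_on g (Pow (univ M)) \<and> g ` Pow (univ M) \<subseteq> UNIV"
    using ordLess_imp_ordLeq[OF Pow] by (simp only: card_of_ordLeq)
  then obtain g :: "'u set \<Rightarrow> 'u" where g: "inj_on g (Pow (univ M))" by (elim exE conjE)
  define code where "code = (\<lambda>N :: ('u, 's, 'p) struct. g (univ N))"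
  have FP: "univ N \<in> Pow (univ M)" if "N \<in> F" for N
    using that le_univ by (auto simp: F_def)
  have inj: "inj_on code F"
  proof (rule inj_onI)
    fix N N' assume N: "N \<in> F" "N' \<in> F" "code N = code N'"
    then have "univ N = univ N'" using inj_onD[OF g _ FP FP] by (simp add: code_def)
    moreover have "substruct \<tau> N M" "substruct \<tau> N' M"
      using N(1,2) le_substruct unfolding F_def by blast+
    ultimately show "N = N'" by (intro substruct_eqI)
  qed
  define I where "I = code ` F"
  define D where "D = the_inv_into F code"
  have DF: "D i \<in> F" if "i \<in> I" for i
    using that inj unfolding D_def I_def by (intro the_inv_into_into) auto
  have codeD: "code (D i) = i" if "i \<in> I" for i
    using that inj unfolding D_def I_def by (intro f_the_inv_into_f) auto
  have Dcode: "D (code N) = N" if "N \<in> F" for N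
    using that inj unfolding D_def by (intro the_inv_into_f_f)
  define r where "r = {(i, j). i \<in> I \<and> j \<in> I \<and> univ (D i) \<subseteq> univ (D j)}"
  have "I \<subseteq> g ` Pow (univ M)" using FP by (auto simp: I_def code_def)
  then have I: "small I"
    unfolding small_def by (rule ordLeq_ordLess_trans[OF surj_imp_ordLeq Pow])
  have hull: "\<exists>N\<in>F. V \<subseteq> univ N" if V: "V \<subseteq> univ M" "|V| <o l" for V
  proof -
    obtain N where N: "(N, M) \<in> le K" "V \<subseteq> univ N" "|univ N| \<le>o weak_power |V| \<mu> +c L"
      using L(1) M V(1) unfolding LST_cardinal_def by blast
    have "weak_power |V| \<mu> +c L <o l"
      unfolding csum_def using linf closed[OF V] L(2)
      by (intro card_of_Plus_ordLess_infinite_Field)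
        (simp_all add: cinfinite_def BNF_Cardinal_Order_Relation.ordLess_Field)
    then have "|univ N| <o l" by (rule ordLeq_ordLess_trans[OF N(3)])
    then show ?thesis using N(1,2) F_def by blast
  qed
  have r: "directed_poset l I r"
    unfolding directed_poset_def
  proof (intro conjI allI impI)
    have "i = j" if "i \<in> I" "j \<in> I" "univ (D i) = univ (D j)" for i j
      using codeD[OF that(1)] codeD[OF that(2)] that(3) by (simp add: code_def)
    then show "partial_order_on I r"
      unfolding partial_order_on_def preorder_on_def r_def
      by (auto simp: refl_on_def intro!: transI antisymI)
    fix A assume A: "A \<subseteq> I" "|A| <o l"
    have "|\<Union>i\<in>A. univ (D i)| <o l"
      using A DF by (intro card_of_UNION_ordLess_infinite_Field_regularCard[OF lreg linf]) (auto simp: F_def)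
    moreover have "(\<Union>i\<in>A. univ (D i)) \<subseteq> univ M" using A DF FP by blast
    ultimately obtain N where N: "N \<in> F" "(\<Union>i\<in>A. univ (D i)) \<subseteq> univ N" using hull by blast
    have "code N \<in> I" using N(1) by (simp add: I_def)
    moreover have "(a, code N) \<in> r" if "a \<in> A" for a
      using that A N Dcode[OF N(1)] calculation by (auto simp: r_def)
    ultimately show "\<exists>b\<in>I. \<forall>a\<in>A. (a, b) \<in> r" by blast
  qed
  have r\<mu>: "directed_poset \<mu> I r" using r l(2) by (rule directed_poset_mono)
  have D: "(D i, M) \<in> le K" if "i \<in> I" for i using DF[OF that] by (simp add: F_def)
  have mono: "univ (D i) \<subseteq> univ (D j)" if "i \<in> I" "j \<in> I" "(i, j) \<in> r" for i j
    using that by (simp add: r_def)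
  have uM: "univ M = (\<Union>i\<in>I. univ (D i))"
  proof
    show "(\<Union>i\<in>I. univ (D i)) \<subseteq> univ M" using DF FP by blast
    show "univ M \<subseteq> (\<Union>i\<in>I. univ (D i))"
    proof
      fix x assume "x \<in> univ M"
      moreover have "|{x}| <o l"
        using linf by (intro finite_ordLess_Cinfinite) simp_all
      ultimately obtain N where "N \<in> F" "x \<in> univ N" using hull[of "{x}"] by auto
      then show "x \<in> (\<Union>i\<in>I. univ (D i))" using Dcode by (force simp: I_def)
    qed
  qed
  let ?d = "\<lambda>i j. \<lambda>x\<in>univ (D i). x" and ?c = "\<lambda>i. \<lambda>x\<in>univ (D i). x"
  note dia = colimit_submodels[OF M I r\<mu> D mono uM]
  have col: "colimit set_category I r (\<lambda>i. Emb M (D i)) (\<lambda>i j. hom_map (cat_of K) M (D i) (?d i j))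
      (Emb M M) (\<lambda>i. hom_map (cat_of K) M (D i) (?c i))"
    using pres I r dia unfolding presentable_def by simp
  have dE: "?d i j \<in> Emb (D i) (D j)" if "i \<in> I" "j \<in> I" "(i, j) \<in> r" for i j
    using dia(1) that by (simp add: diagram_def)
  \<comment> \<open>The covering lemma needs two distinct elements of the type of arrows; constant
    functions with distinct values in \<open>M\<close> serve.\<close>
  have "infinite (univ M)"
    using cinfinite_mono[OF l(3)] linf by (simp add: cinfinite_def Field_card_of)
  then obtain u v where "u \<in> univ M" "v \<in> univ M - {u}"
    by (metis ex_in_conv finite.emptyI finite_insert insert_Diff_single infinite_remove)
  then have uv: "(\<lambda>_. u) \<noteq> (\<lambda>_ :: 'u. v)" by (auto simp: fun_eq_iff)
  have idM: "(\<lambda>x\<in>univ M. x) \<in> Emb M M" using Emb_inclusion[OF le_refl[OF M]] .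
  have "\<exists>i\<in>I. (\<lambda>x\<in>univ M. x) \<in> hom_map (cat_of K) M (D i) (?c i) ` Emb M (D i)"
  proof (rule colimit_set_category_covers[OF col idM uv])
    fix i j assume ij: "i \<in> I" "j \<in> I" "(i, j) \<in> r"
    show "hom_map (cat_of K) M (D i) (?d i j) \<in> Emb M (D i) \<rightarrow> Emb M (D j)"
      using Emb_comp[OF _ dE[OF ij]] by (simp add: hom_map_apply)
  qed
  then obtain i f where i: "i \<in> I" "f \<in> Emb M (D i)" by blast
  \<comment> \<open>Covering the identity requires some embedding of \<open>M\<close> into
    \<open>D i\<close>, but \<open>D i\<close> has fewer than \<open>l\<close> and so fewer points
    than \<open>M\<close>.\<close>
  have "|univ M| \<le>o |univ (D i)|"
    using Emb_inj[OF i(2)] Emb_image[OF i(2)] card_of_ordLeq by blast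
  moreover have "|univ (D i)| <o |univ M|"
    using DF[OF i(1)] l(3) ordLess_ordLeq_trans by (auto simp: F_def)
  ultimately show False using not_ordLess_ordLeq by blast
qed

end

section \<open>The presentability rank\<close>

context mu_aec
begin

lemma mu_le_LST: "LST_cardinal \<mu> K L \<Longrightarrow> \<mu> \<le>o L"
  unfolding LST_cardinal_def using ordLeq_transitive[OF ordLeq_csum2] Cinfinite by blast

text \<open>The test cardinal is the successor of |A| to the power <\<mu>: it is regular, lies above
  \<open>r'\<close> and \<open>L\<close>, and is at most |M|. Presentability at \<open>r'\<close>
  would pass up to it.\<close>

lemma not_presentable_closure:
  fixes L r' :: "'u rel" and A :: "'u set"
  assumes M: "M \<in> models K" and Pow: "|Pow (univ M)| <o |UNIV :: 'u set|"
    and L: "LST_cardinal \<mu> K L"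
    and A: "infinite A" "L \<le>o |A|" "r' \<le>o |A|" "weak_power |A| \<mu> <o |univ M|"
  shows "\<not> presentable (cat_of K) r' M"
proof
  assume pres: "presentable (cat_of K) r' M"
  let ?\<kappa> = "weak_power |A| \<mu>"
  have C\<kappa>: "Card_order ?\<kappa>" by (rule Card_order_weak_power)
  have A\<kappa>: "|A| \<le>o ?\<kappa>" by (rule le_weak_power(1)[OF Cinfinite card_of_Card_order])
  have "cinfinite |A|" using A(1) by (simp add: cinfinite_def Field_card_of)
  then have inf: "Cinfinite ?\<kappa>" using C\<kappa> cinfinite_mono[OF A\<kappa>] by simp
  have "cardSuc ?\<kappa> \<le>o |univ M|" by (rule cardSuc_least[OF C\<kappa> card_of_Card_order A(4)])
  then have "\<exists>C \<subseteq> univ M. |C| =o cardSuc ?\<kappa>" by (rule ordLeq_card_of_subset[OF cardSuc_Card_order[OF C\<kappa>]])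
  then obtain C where C: "C \<subseteq> univ M" "|C| =o cardSuc ?\<kappa>" by (elim exE conjE)
  have \<kappa>C: "?\<kappa> <o |C|"
    by (rule ordLess_ordIso_trans[OF cardSuc_greater[OF C\<kappa>] ordIso_symmetric[OF C(2)]])
  then have AC: "|A| <o |C|" by (rule ordLeq_ordLess_trans[OF A\<kappa>])
  have "cardinal |C|"
    using models_struct[OF M] C(1) by (intro cardinal_card_of_subset) (auto simp: is_struct_def)
  then have reg: "regular_cardinal |C|"
    by (rule regular_cardinal_cong[OF Cinfinite_cardSuc[OF inf] regularCard_cardSuc[OF inf] ordIso_symmetric[OF C(2)]])
  have LC: "L <o |C|" by (rule ordLeq_ordLess_trans[OF A(2) AC])
  \<comment> \<open>Anything below the successor is at most \<open>?\<kappa>\<close>, and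
    \<open>?\<kappa>\<close> is stable under a further weak power.\<close>
  have "weak_power |B| \<mu> <o |C|" if B: "|B| <o |C|" for B :: "'u set"
  proof -
    have "|B| <o cardSuc ?\<kappa>" using B C(2) by (rule ordLess_ordIso_trans)
    then have "|B| \<le>o ?\<kappa>" by (rule iffD1[OF cardSuc_ordLeq_ordLess[OF C\<kappa> card_of_Card_order]])
    then have "weak_power |B| \<mu> \<le>o weak_power ?\<kappa> \<mu>" by (intro weak_power_mono card_of_mono2)
    also have "weak_power ?\<kappa> \<mu> \<le>o ?\<kappa>"
      using regular A(1) Cinfinite by (intro weak_power_idem) (simp_all add: regular_cardinal_def)
    finally show ?thesis using \<kappa>C by (rule ordLeq_ordLess_trans)
  qed
  then have "\<not> presentable (cat_of K) |C| M"
    using not_presentable[OF M Pow L LC reg _ card_of_mono1[OF C(1)]]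
      ordLess_imp_ordLeq[OF ordLeq_ordLess_trans[OF mu_le_LST[OF L] LC]] by blast
  moreover have "presentable (cat_of K) |C| M"
    using pres ordLess_imp_ordLeq[OF ordLeq_ordLess_trans[OF A(3) AC]] by (rule presentable_mono)
  ultimately show False by contradiction
qed

text \<open>Chooses \<open>A\<close> of size \<open>r'\<close> plus \<open>L\<close>, which the
  infinite \<open>l\<close> keeps within reach of \<open>closed\<close>. Later \<open>l\<close> is
  either |M| itself or its cardinal predecessor.\<close>

lemma not_presentable_join:
  fixes L r' l :: "'u rel"
  assumes M: "M \<in> models K" and Pow: "|Pow (univ M)| <o |UNIV :: 'u set|"
    and L: "LST_cardinal \<mu> K L" and r': "Card_order r'"
    and l: "Card_order l" "l \<le>o |univ M|" "L <o l" "r' <o l"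
    and closed: "\<And>A. A \<subseteq> univ M \<Longrightarrow> |A| <o l \<Longrightarrow> weak_power |A| \<mu> <o |univ M|"
  shows "\<not> presentable (cat_of K) r' M"
proof -
  have CL: "Card_order L" using L by (simp add: LST_cardinal_def cardinal_def)
  have Linf: "cinfinite L" using cinfinite_mono[OF mu_le_LST[OF L]] Cinfinite by simp
  have linf: "cinfinite l" using cinfinite_mono[OF ordLess_imp_ordLeq[OF l(3)] Linf] .
  have less: "r' +c L <o l"
    unfolding csum_def using linf l
    by (intro card_of_Plus_ordLess_infinite_Field)
      (simp_all add: cinfinite_def BNF_Cardinal_Order_Relation.ordLess_Field)
  have "\<exists>A \<subseteq> univ M. |A| =o r' +c L"
    by (rule ordLeq_card_of_subset[OF Card_order_csum ordLeq_transitive[OF ordLess_imp_ordLeq[OF less] l(2)]])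
  then obtain A where A: "A \<subseteq> univ M" "|A| =o r' +c L" by (elim exE conjE)
  note sym = ordIso_symmetric[OF A(2)]
  have LA: "L \<le>o |A|" by (rule ordLeq_ordIso_trans[OF ordLeq_csum2[OF CL] sym])
  moreover have "r' \<le>o |A|" by (rule ordLeq_ordIso_trans[OF ordLeq_csum1[OF r'] sym])
  moreover have "infinite A" using cinfinite_mono[OF LA Linf] by (simp add: cinfinite_def Field_card_of)
  moreover have "weak_power |A| \<mu> <o |univ M|"
    by (rule closed[OF A(1) ordIso_ordLess_trans[OF A(2) less]])
  ultimately show ?thesis by (intro not_presentable_closure[OF M Pow L])
qed

text \<open>Below |M| a successor of a weak power serves as test cardinal. If \<open>r'\<close>
  equals |M|, no such successor has to fit under |M|: \<open>r'\<close> is itself regular and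
  closed, and tests directly.\<close>

lemma not_presentable_le:
  fixes L r' :: "'u rel"
  assumes M: "M \<in> models K" and Pow: "|Pow (univ M)| <o |UNIV :: 'u set|"
    and L: "LST_cardinal \<mu> K L" "L <o |univ M|"
    and closed: "\<And>A. A \<subseteq> univ M \<Longrightarrow> |A| <o |univ M| \<Longrightarrow> weak_power |A| \<mu> <o |univ M|"
    and r': "regular_cardinal r'" "r' \<le>o |univ M|"
  shows "\<not> presentable (cat_of K) r' M"
proof (cases "r' <o |univ M|")
  case True
  have "Card_order r'" using r'(1) by (simp add: regular_cardinal_def cardinal_def)
  then show ?thesis
    using card_of_Card_order ordLeq_refl[OF card_of_Card_order] L(2) True closed
    by (rule not_presentable_join[OF M Pow L(1)])
next
  case False
  then have eq: "r' =o |univ M|" using r'(2) by (simp add: ordLeq_iff_ordLess_or_ordIso)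
  have L': "L <o r'" by (rule ordLess_ordIso_trans[OF L(2) ordIso_symmetric[OF eq]])
  have "weak_power |A| \<mu> <o r'" if "A \<subseteq> univ M" "|A| <o r'" for A
    by (rule ordLess_ordIso_trans[OF closed[OF that(1) ordLess_ordIso_trans[OF that(2) eq]]
      ordIso_symmetric[OF eq]])
  then show ?thesis
    using ordLess_imp_ordLeq[OF ordLeq_ordLess_trans[OF mu_le_LST[OF L(1)] L']]
    by (intro not_presentable[OF M Pow L(1) L' r'(1) _ r'(2)])
qed

text \<open>Once all regular cardinals up to |M| are excluded, the successor of |M| is the least
  candidate, and \<open>presentable_large\<close> shows that it works.\<close>

lemma successor_rank:
  assumes M: "M \<in> models K" and Pow: "|Pow (univ M)| <o |UNIV :: 'u set|"
    and le: "\<mu> \<le>o |univ M|"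
    and no: "\<And>r' :: 'u rel. regular_cardinal r' \<Longrightarrow> r' \<le>o |univ M| \<Longrightarrow> \<not> presentable (cat_of K) r' M"
  shows "(\<exists>r :: 'u rel. is_presentability_rank (cat_of K) M r \<and> r =o cardSuc |univ M| ) \<and>
        is_internal_size (cat_of K) M |univ M|"
proof -
  let ?B = "univ M"
  have CB: "Card_order |?B|" by (rule card_of_Card_order)
  have inf: "Cinfinite |?B|" using CB cinfinite_mono[OF le] Cinfinite by simp
  \<comment> \<open>The successor is at most the power set, so it has a small copy on
    \<open>'u\<close>.\<close>
  have less: "cardSuc |?B| <o |UNIV :: 'u set|"
    by (rule ordLeq_ordLess_trans[OF cardSuc_least[OF CB card_of_Card_order card_of_Pow] Pow])
  have "\<exists>C \<subseteq> (UNIV :: 'u set). |C| =o cardSuc |?B|"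
    by (rule ordLeq_card_of_subset[OF cardSuc_Card_order[OF CB] ordLess_imp_ordLeq[OF less]])
  then obtain C :: "'u set" where C: "|C| =o cardSuc |?B|" by (elim exE conjE)
  have "small C" unfolding small_def by (rule ordIso_ordLess_trans[OF C less])
  then have "cardinal |C|" by (rule cardinal_card_of_subset) simp
  then have reg: "regular_cardinal |C|"
    by (rule regular_cardinal_cong[OF Cinfinite_cardSuc[OF inf] regularCard_cardSuc[OF inf] ordIso_symmetric[OF C]])
  have BC: "|?B| <o |C|"
    by (rule ordLess_ordIso_trans[OF cardSuc_greater[OF CB] ordIso_symmetric[OF C]])
  have "presentable (cat_of K) |C| M"
    using reg ordLeq_transitive[OF le ordLess_imp_ordLeq[OF BC]]
    by (intro presentable_large[OF M BC]) (simp_all add: regular_cardinal_def cardinal_def)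
  moreover have "|C| \<le>o r'" if r': "regular_cardinal r'" "presentable (cat_of K) r' M" for r' :: "'u rel"
  proof -
    have C': "Card_order r'" using r'(1) by (simp add: regular_cardinal_def cardinal_def)
    then have "|?B| <o r'" using ordLess_or_ordLeq_Card[OF CB C'] no[OF r'(1)] r'(2) by blast
    then have "cardSuc |?B| \<le>o r'" by (rule cardSuc_least[OF CB C'])
    with C show ?thesis by (rule ordIso_ordLeq_trans)
  qed
  ultimately have rank: "is_presentability_rank (cat_of K) M |C|"
    using reg by (simp add: is_presentability_rank_def)
  have "small ?B" using models_struct[OF M] by (simp add: is_struct_def)
  then have "cardinal |?B|" by (rule cardinal_card_of_subset) simp
  then show ?thesis using rank C unfolding is_internal_size_def by blast
qed

end

text \<open>The assumption on \<open>Pow (univ M)\<close> says that \<open>'u\<close> is large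
  compared with \<open>M\<close>: it accommodates the successor of |M| and an index set for the
  submodels of \<open>M\<close>.\<close>

theorem theorem4p13:
  fixes \<mu> LS :: "'u rel" and K :: "('u, 's, 'p) aclass" and M :: "('u, 's, 'p) struct"
  assumes "mu_AEC \<mu> K" and "M \<in> models K"
    and "|Pow (univ M)| <o |UNIV :: 'u set|"
    and "is_LS \<mu> K LS" and "LS <o |univ M|"
    and "GCH TYPE('u) \<or> SCH \<mu> |univ M|"
  shows "(\<not> (\<exists>l0 :: 'u rel. cardinal l0 \<and> |univ M| =o cardSuc l0 \<and> cofinality l0 <o \<mu>) \<longrightarrow>
        (\<exists>r :: 'u rel. is_presentability_rank (cat_of K) M r \<and> r =o cardSuc |univ M| ) \<and>
        is_internal_size (cat_of K) M |univ M| ) \<and>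
      (\<forall>l0 :: 'u rel. cardinal l0 \<and> |univ M| =o cardSuc l0 \<and> cofinality l0 <o \<mu> \<longrightarrow>
        is_internal_size (cat_of K) M l0 \<or> is_internal_size (cat_of K) M |univ M| )"
proof -
  interpret mu_aec \<mu> K using assms(1) by unfold_locales
  note M = assms(2) and Pow = assms(3)
  let ?B = "univ M"
  have B: "small ?B" using models_struct[OF M] by (simp add: is_struct_def)
  have CB: "Card_order |?B|" by (rule card_of_Card_order)
  have L: "LST_cardinal \<mu> K LS" using assms(4) by (simp add: is_LS_def)
  have CL: "Card_order LS" using L by (simp add: LST_cardinal_def cardinal_def)
  have \<mu>B: "\<mu> <o |?B|" by (rule ordLeq_ordLess_trans[OF mu_le_LST[OF L] assms(5)])
  have Linf: "Cinfinite LS" using CL cinfinite_mono[OF mu_le_LST[OF L]] Cinfinite by simp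
  have sch: "SCH \<mu> |?B|" using assms(6) GCH_imp_SCH[OF _ regular \<mu>B] by blast
  note rank = successor_rank[OF M Pow ordLess_imp_ordLeq[OF \<mu>B]]
  show ?thesis
  proof (intro conjI[of "_ \<longrightarrow> _"] impI allI)
    assume nsucc: "\<not> (\<exists>l0 :: 'u rel. cardinal l0 \<and> |?B| =o cardSuc l0 \<and> cofinality l0 <o \<mu>)"
    have "weak_power |A| \<mu> <o |?B|" if A: "A \<subseteq> ?B" "|A| <o |?B|" for A
    \<comment> \<open>Either |M| is the successor of some \<open>l0\<close>, whose cofinality is
      then not below \<mu>, or it is no successor at all.\<close>
    proof (cases "\<exists>l0 :: 'u rel. cardinal l0 \<and> |?B| =o cardSuc l0")
      case True
      then obtain l0 :: "'u rel" where l0: "cardinal l0" "|?B| =o cardSuc l0" by (elim exE conjE)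
      have Cl0: "Card_order l0" using l0(1) by (simp add: cardinal_def)
      have "\<not> cofinality l0 <o \<mu>" using nsucc l0 by blast
      moreover have "|A| \<le>o l0"
        by (rule iffD1[OF cardSuc_ordLeq_ordLess[OF Cl0 card_of_Card_order] ordLess_ordIso_trans[OF A(2) l0(2)]])
      ultimately have "weak_power |A| \<mu> \<le>o l0"
        by (rule closed_below_successor[OF Cinfinite SCH_successor[OF sch l0]])
      then show ?thesis
        by (rule ordLeq_ordLess_trans[OF _ ordLess_ordIso_trans[OF cardSuc_greater[OF Cl0] ordIso_symmetric[OF l0(2)]]])
    next
      case False
      then show ?thesis using A by (rule closed_below_limit[OF B sch])
    qed
    then show "(\<exists>r :: 'u rel. is_presentability_rank (cat_of K) M r \<and> r =o cardSuc |?B| ) \<and>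
        is_internal_size (cat_of K) M |?B|"
      by (intro rank not_presentable_le[OF M Pow L assms(5)])
  next
    fix l0 :: "'u rel"
    assume "cardinal l0 \<and> |?B| =o cardSuc l0 \<and> cofinality l0 <o \<mu>"
    then have l0: "cardinal l0" "|?B| =o cardSuc l0" "cofinality l0 <o \<mu>" by simp_all
    have Cl0: "Card_order l0" using l0(1) by (simp add: cardinal_def)
    have l0B: "l0 <o |?B|"
      by (rule ordLess_ordIso_trans[OF cardSuc_greater[OF Cl0] ordIso_symmetric[OF l0(2)]])
    have closed: "almost_closed \<mu> l0" by (rule SCH_successor[OF sch l0(1,2)])
    have LSl0: "LS \<le>o l0"
      by (rule iffD1[OF cardSuc_ordLeq_ordLess[OF Cl0 CL] ordLess_ordIso_trans[OF assms(5) l0(2)]])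
    \<comment> \<open>\<open>cofinality\<close> is meaningful for infinite cardinals;
      \<open>l0\<close> is one, since it is at least \<open>LS\<close>.\<close>
    have inf: "Cinfinite l0" using Cl0 cinfinite_mono[OF LSl0] Linf by simp
    \<comment> \<open>With this, only |M| and its successor remain as possible ranks.\<close>
    have small_no: "\<not> presentable (cat_of K) r' M"
      if r': "regular_cardinal r'" "r' \<le>o l0" for r' :: "'u rel"
    proof (cases "LS <o l0")
      case True
      have Cr': "Cinfinite r'" "regularCard r'"
        using r'(1) by (simp_all add: regular_cardinal_def cardinal_def)
      \<comment> \<open>\<open>r'\<close> is regular, whereas the cofinality of \<open>l0\<close> is
        less than \<mu> and \<mu> is at most \<open>l0\<close>.\<close>
      have "\<not> r' =o l0"
      proof
        assume "r' =o l0"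
        then have "regularCard l0" by (rule regularCard_ordIso[OF _ Cr'])
        then have "l0 =o cofinality l0" by (rule ordIso_symmetric[OF cofinality_regular[OF inf]])
        then have "l0 <o \<mu>" using l0(3) by (rule ordIso_ordLess_trans)
        then show False
          using not_ordLess_ordLeq[of l0 \<mu>] ordLeq_transitive[OF mu_le_LST[OF L] LSl0] by simp
      qed
      then have "r' <o l0" using r'(2) by (simp add: ordLeq_iff_ordLess_or_ordIso)
      moreover have "weak_power |A| \<mu> <o |?B|" if A: "A \<subseteq> ?B" "|A| <o l0" for A
      proof -
        have "cardinal |A|" by (rule cardinal_card_of_subset[OF B A(1)])
        then have "weak_power |A| \<mu> \<le>o l0" using closed A(2) by (simp add: almost_closed_def)
        then show ?thesis using l0B by (rule ordLeq_ordLess_trans)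
      qed
      ultimately show ?thesis
        using Cr'(1) by (intro not_presentable_join[OF M Pow L _ Cl0 ordLess_imp_ordLeq[OF l0B] True]) simp_all
    next
      case False
      \<comment> \<open>Here no cardinal strictly between \<open>LS\<close> and |M| is left, but
        \<open>LS\<close> equals its own weak power by definition, so a set of size
        \<open>LS\<close> can play the role of \<open>A\<close>.\<close>
      then have eq: "LS =o l0" using LSl0 by (simp add: ordLeq_iff_ordLess_or_ordIso)
      have "\<exists>A \<subseteq> ?B. |A| =o LS"
        by (rule ordLeq_card_of_subset[OF CL ordLess_imp_ordLeq[OF assms(5)]])
      then obtain A where A: "A \<subseteq> ?B" "|A| =o LS" by (elim exE conjE)
      have LA: "LS \<le>o |A|" by (rule ordIso_imp_ordLeq[OF ordIso_symmetric[OF A(2)]])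
      have "infinite A"
        using cinfinite_mono[OF LA] Linf by (simp add: cinfinite_def Field_card_of)
      moreover have "r' \<le>o |A|"
        by (rule ordLeq_ordIso_trans[OF r'(2) ordIso_transitive[OF ordIso_symmetric[OF eq] ordIso_symmetric[OF A(2)]]])
      moreover have "weak_power |A| \<mu> <o |?B|"
      proof -
        have "weak_power |A| \<mu> \<le>o weak_power LS \<mu>"
          by (rule weak_power_mono[OF card_of_mono2[OF ordIso_imp_ordLeq[OF A(2)]]])
        also have "weak_power LS \<mu> =o LS"
          by (rule ordIso_symmetric) (use L in \<open>simp add: LST_cardinal_def\<close>)
        finally show ?thesis using assms(5) by (rule ordLeq_ordLess_trans)
      qed
      ultimately show ?thesis using LA by (intro not_presentable_closure[OF M Pow L])
    qed
    show "is_internal_size (cat_of K) M l0 \<or> is_internal_size (cat_of K) M |?B|"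
    \<comment> \<open>As a successor, |M| is regular. If \<open>M\<close> is presentable there, the
      rank is |M| and the internal size is its predecessor \<open>l0\<close>.\<close>
    proof (cases "presentable (cat_of K) |?B| M")
      case True
      have "cardinal |?B|" using B by (rule cardinal_card_of_subset) simp
      then have reg: "regular_cardinal |?B|"
        by (rule regular_cardinal_cong[OF Cinfinite_cardSuc[OF inf] regularCard_cardSuc[OF inf] ordIso_symmetric[OF l0(2)]])
      have "|?B| \<le>o r'" if r': "regular_cardinal r'" "presentable (cat_of K) r' M" for r' :: "'u rel"
      proof -
        have C': "Card_order r'" using r'(1) by (simp add: regular_cardinal_def cardinal_def)
        then have "l0 <o r'" using ordLess_or_ordLeq_Card[OF Cl0 C'] small_no[OF r'(1)] r'(2) by blast
        then have "cardSuc l0 \<le>o r'" by (rule cardSuc_least[OF Cl0 C'])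
        with l0(2) show ?thesis by (rule ordIso_ordLeq_trans)
      qed
      then have "is_presentability_rank (cat_of K) M |?B|"
        using reg True by (simp add: is_presentability_rank_def)
      then show ?thesis using l0(1,2) unfolding is_internal_size_def by blast
    next
      case False
      \<comment> \<open>Presentability passes to larger cardinals, so failure at |M| excludes
        everything up to |M|.\<close>
      then have "\<not> presentable (cat_of K) r' M" if "r' \<le>o |?B|" for r' :: "'u rel"
        using presentable_mono[OF _ that, of "cat_of K" M] by blast
      then show ?thesis using rank by blast
    qed
  qed
qed

end
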